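(* Let $T^{\mathrm o}=\sum_{\ell\ge0}\sum_{m=-\ell}^{\ell}a^{\mathrm o}_{\ell,m}Y_{\ell,m}$ be a real random field on $\mathbb{S}^2$ in $L_2(\Omega\times\mathbb{S}^2)$, let $(\beta_\ell)_{\ell\ge0}$ be positive numbers and $\lambda>0$, and let $T^{\mathrm r}=\sum_{\ell\ge0}\sum_{m=-\ell}^{\ell}a^{\mathrm r}_{\ell,m}Y_{\ell,m}$ be the regularized field, where for each realization \[ a^{\mathrm r}_{\ell,m}=\begin{cases}\Big(1-\dfrac{\lambda\beta_\ell}{A^{\mathrm o}_\ell}\Big)a^{\mathrm o}_{\ell,m}, & A^{\mathrm o}_\ell>\lambda\beta_\ell,\\ 0, & A^{\mathrm o}_\ell\le\lambda\beta_\ell,\end{cases}\qquad A^{\mathrm o}_\ell:=\Big(\sum_{m=-\ell}^{\ell}|a^{\mathrm o}_{\ell,m}|^2\Big)^{1/2} \] (equivalently, $(a^{\mathrm r}_{\ell,m})$ is the minimizer of $\tfrac12\sum_{\ell,m}|a_{\ell,m}-a^{\mathrm o}_{\ell,m}|^2+\lambda\sum_\ell\beta_\ell(\sum_m|a_{\ell,m}|^2)^{1/2}$). If $T^{\mathrm o}$ is strongly isotropic, then $T^{\mathrm r}$ is strongly isotropic.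
   Context: Random fields are maps $\Omega\times\mathbb{S}^2\to\mathbb{R}$ on a probability space $(\Omega,\mathcal F,\mathbb P)$, measurable w.r.t. $\mathcal F\otimes\mathcal B(\mathbb{S}^2)$; $L_2(\Omega\times\mathbb{S}^2)$ is with respect to $\mathbb P\otimes\sigma$, $\sigma$ the surface measure on $\mathbb{S}^2$ with $\sigma(\mathbb{S}^2)=4\pi$. $\{Y_{\ell,m}\}$ is the standard complex orthonormal basis of spherical harmonics and $a^{\mathrm o}_{\ell,m}=\int_{\mathbb{S}^2}T^{\mathrm o}\overline{Y_{\ell,m}}\,d\sigma$. A field $T$ is strongly isotropic if for every $k\in\mathbb N$, all $\mathbf x_1,\dots,\mathbf x_k\in\mathbb{S}^2$ and every rotation $\rho\in SO(3)$, $(T(\mathbf x_1),\dots,T(\mathbf x_k))$ and $(T(\rho\mathbf x_1),\dots,T(\rho\mathbf x_k))$ have the same joint distribution. *)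

theory Defs
  imports "HOL-Analysis.Analysis" "HOL-Probability.Probability"
    "HOL-Computational_Algebra.Polynomial"
begin

text \<open>The unit sphere is \<open>sphere 0 1 :: (real^3) set\<close>.
  Surface measure sigma: sigma(A) = 3 * Lebesgue measure of the cone
  {t x : x in A, 0 < t <= 1}; total mass 4 pi. It is realised as a measure
  on the Borel sets of R^3 concentrated on the unit sphere.\<close>

definition sphere_measure :: "(real^3) measure" where
  "sphere_measure = scale_measure 3
     (distr (restrict_space lborel (ball 0 1 - {0})) borel (\<lambda>x. x /\<^sub>R norm x))"

text \<open>Legendre polynomial via Rodrigues' formula.\<close>
definition legendre_poly :: "nat \<Rightarrow> real poly" where
  "legendre_poly l = smult (1 / (2 ^ l * fact l)) ((pderiv ^^ l) ([:-1, 0, 1:] ^ l))"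

text \<open>Standard complex spherical harmonics (Condon--Shortley phase) in Cartesian
  coordinates: for x on the sphere, cos theta = x3 and sin theta e^{i phi} = x1 + i x2, so
  P_l^m(cos theta) e^{i m phi} = (-1)^m P_l^{(m)}(x3) (x1 + i x2)^m for m >= 0,
  and Y_{l,-m} = (-1)^m conj(Y_{l,m}).\<close>
definition sph_harm_nonneg :: "nat \<Rightarrow> nat \<Rightarrow> real^3 \<Rightarrow> complex" where
  "sph_harm_nonneg l m x =
     complex_of_real (sqrt ((2 * real l + 1) / (4 * pi) * (fact (l - m) / fact (l + m)))
        * (-1) ^ m * poly ((pderiv ^^ m) (legendre_poly l)) (x $ 3))
     * (Complex (x $ 1) (x $ 2)) ^ m"

definition sph_harm :: "nat \<Rightarrow> int \<Rightarrow> real^3 \<Rightarrow> complex" where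
  "sph_harm l m x =
     (if m \<ge> 0 then sph_harm_nonneg l (nat m) x
      else (-1) ^ nat (- m) * cnj (sph_harm_nonneg l (nat (- m)) x))"

definition sh_coeff :: "(real^3 \<Rightarrow> real) \<Rightarrow> nat \<Rightarrow> int \<Rightarrow> complex" where
  "sh_coeff f l m = (\<integral>x. complex_of_real (f x) * cnj (sph_harm l m x) \<partial>sphere_measure)"

definition degree_norm :: "(real^3 \<Rightarrow> real) \<Rightarrow> nat \<Rightarrow> real" where
  "degree_norm f l = sqrt (\<Sum>m\<in>{-int l..int l}. (cmod (sh_coeff f l m))\<^sup>2)"

definition reg_coeff :: "real \<Rightarrow> (nat \<Rightarrow> real) \<Rightarrow> (real^3 \<Rightarrow> real) \<Rightarrow> nat \<Rightarrow> int \<Rightarrow> complex" where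
  "reg_coeff lam beta f l m =
     (if degree_norm f l > lam * beta l
      then complex_of_real (1 - lam * beta l / degree_norm f l) * sh_coeff f l m
      else 0)"

text \<open>Regularised field, as the pointwise series sum_l sum_{m=-l..l} a^r_{l,m} Y_{l,m}(x)
  (real part; the series is real-valued by the symmetry of the coefficients).\<close>
definition regularized_field ::
  "real \<Rightarrow> (nat \<Rightarrow> real) \<Rightarrow> ('a \<Rightarrow> real^3 \<Rightarrow> real) \<Rightarrow> 'a \<Rightarrow> real^3 \<Rightarrow> real" where
  "regularized_field lam beta T \<omega> x =
     Re (\<Sum>l. \<Sum>m\<in>{-int l..int l}. reg_coeff lam beta (T \<omega>) l m * sph_harm l m x)"

definition strongly_isotropic :: "'a measure \<Rightarrow> ('a \<Rightarrow> real^3 \<Rightarrow> real) \<Rightarrow> bool" where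
  "strongly_isotropic M T \<longleftrightarrow>
     (\<forall>k::nat. \<forall>xs :: nat \<Rightarrow> real^3. \<forall>\<rho> :: real^3^3.
        (\<forall>i<k. xs i \<in> sphere 0 1) \<longrightarrow> rotation_matrix \<rho> \<longrightarrow>
        distr M (PiM {..<k} (\<lambda>_. borel)) (\<lambda>\<omega>. \<lambda>i\<in>{..<k}. T \<omega> (xs i)) =
        distr M (PiM {..<k} (\<lambda>_. borel)) (\<lambda>\<omega>. \<lambda>i\<in>{..<k}. T \<omega> (\<rho> *v xs i)))"

definition random_field :: "'a measure \<Rightarrow> ('a \<Rightarrow> real^3 \<Rightarrow> real) \<Rightarrow> bool" where
  "random_field M T \<longleftrightarrow> (\<lambda>(\<omega>, x). T \<omega> x) \<in> borel_measurable (M \<Otimes>\<^sub>M sphere_measure)"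

definition L2_field :: "'a measure \<Rightarrow> ('a \<Rightarrow> real^3 \<Rightarrow> real) \<Rightarrow> bool" where
  "L2_field M T \<longleftrightarrow> random_field M T \<and>
     integrable (M \<Otimes>\<^sub>M sphere_measure) (\<lambda>(\<omega>, x). (T \<omega> x)\<^sup>2)"

end

theory Submission
  imports Defs
begin

text \<open>
  The idea is to push the rotation from the argument of the regularized field into the
  original field. Up to normalisation, \<open>\<Sum>\<^sub>m Y\<^sub>l\<^sub>m(x) cnj (Y\<^sub>l\<^sub>m(y))\<close> is the
  Legendre polynomial \<open>P\<^sub>l(x \<bullet> y)\<close>, hence invariant under rotating both arguments. Both the
  degree-\<open>l\<close> component of a function and the norm of its degree-\<open>l\<close> coefficients are integrals
  against this kernel, so the regularization of \<open>T\<close> at \<open>\<rho> x\<close> is the regularization of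
  \<open>T \<circ> \<rho>\<close> at \<open>x\<close>. Now \<open>T\<close> and \<open>T \<circ> \<rho>\<close> have the same finite-dimensional distributions,
  and these determine the joint law of all coefficients: a coefficient is a limit in
  probability of averages over independent uniform sample points, and for fixed sample
  points the law of these averages is a function of a finite-dimensional distribution.
\<close>

text \<open>Isotropy speaks of finitely many fixed points, whereas a coefficient integrates a
  realization that is merely square integrable in space, so sums over a fixed grid need not converge
  to it. Points drawn independently of the field avoid this: for almost every realization a variance
  bound gives convergence, and Fubini then lets the field be averaged first, at frozen points. The
  kernel is evaluated without representation theory. It is constant along rotations about the third
  axis because phases cancel, and along rotations about the first axis because its derivative
  telescopes over the order \<open>m\<close>. These two families carry any unit vector to the pole,
  where only \<open>m = 0\<close> survives. Under a rotation the coefficients of one degree mix with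
  each other, but the shrinkage factor depends on the degree alone. This is why whole degree
  components, and not single coefficients, are compared pathwise.\<close>

section \<open>Finite-dimensional distributions determine the law of integrals\<close>

text \<open>The tents \<open>max 0 (1 - n * infdist x A)\<close> are Lipschitz and decrease to the
  indicator of a closed set, and closed sets form an intersection-stable generator. Testing against
  Lipschitz functions reduces equality of laws to estimates of mean distances.\<close>

lemma measure_eqI_Lipschitz:
  fixes P Q :: "'b::metric_space measure"
  assumes "finite_measure P" "finite_measure Q"
    and sets: "sets P = sets borel" "sets Q = sets borel"
    and eq: "\<And>\<phi> C. (\<And>x y. \<bar>\<phi> x - \<phi> y\<bar> \<le> C * dist x y) \<Longrightarrow> (\<And>x. \<phi> x \<in> {0..1::real}) \<Longrightarrow>
        integral\<^sup>L P \<phi> = integral\<^sup>L Q \<phi>"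
  shows "P = Q"
proof -
  interpret P: finite_measure P by fact
  interpret Q: finite_measure Q by fact
  note [measurable_cong] = sets
  have space: "space P = UNIV" "space Q = UNIV"
    using sets_eq_imp_space_eq[OF sets(1)] sets_eq_imp_space_eq[OF sets(2)] by simp_all
  have closed: "measure P A = measure Q A" if A: "closed A" for A
  \<comment> \<open>By convention \<open>infdist x {} = 0\<close>, so the tents over the empty set
    would be constantly 1.\<close>
  proof (cases "A = {}")
    case False
    have [measurable]: "A \<in> sets borel" using A by simp
    define \<phi> where "\<phi> n x = max 0 (1 - real n * infdist x A)" for n x
    have lip: "\<bar>\<phi> n x - \<phi> n y\<bar> \<le> real n * dist x y" for n x y
    proof -
      have "\<bar>\<phi> n x - \<phi> n y\<bar> \<le> \<bar>real n * infdist x A - real n * infdist y A\<bar>"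
        unfolding \<phi>_def by linarith
      also have "\<dots> = real n * \<bar>infdist x A - infdist y A\<bar>"
        by (simp add: abs_mult flip: right_diff_distrib)
      also have "\<dots> \<le> real n * dist x y"
        by (intro mult_left_mono infdist_triangle_abs) auto
      finally show ?thesis .
    qed
    have range: "\<phi> n x \<in> {0..1}" for n x
      by (simp add: \<phi>_def infdist_nonneg)
    have meas: "\<phi> n \<in> borel_measurable borel" for n
      unfolding \<phi>_def by (intro borel_measurable_continuous_onI continuous_intros)
    have lim: "(\<lambda>n. \<phi> n x) \<longlonglongrightarrow> indicator A x" for x
    proof (cases "x \<in> A")
      case True
      then show ?thesis by (simp add: \<phi>_def)
    next
      case F: False
      then have pos: "infdist x A > 0"
        using A False by (metis infdist_nonneg in_closed_iff_infdist_zero less_eq_real_def)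
      obtain N :: nat where N: "1 / infdist x A < N" using reals_Archimedean2 by blast
      have "\<phi> n x = 0" if "n \<ge> N" for n
      proof -
        have "1 / infdist x A \<le> real n" using N that by linarith
        then have "1 \<le> real n * infdist x A" using pos by (simp add: field_simps)
        then show ?thesis by (simp add: \<phi>_def)
      qed
      then have "\<forall>\<^sub>F n in sequentially. \<phi> n x = indicator A x"
        using F by (auto intro: eventually_sequentiallyI)
      then show ?thesis by (rule tendsto_eventually)
    qed
    have conv: "(\<lambda>n. integral\<^sup>L R (\<phi> n)) \<longlonglongrightarrow> measure R A"
      if "finite_measure R" and sR [measurable_cong]: "sets R = sets borel" for R
    proof -
      interpret R: finite_measure R by fact
      have "(\<lambda>n. integral\<^sup>L R (\<phi> n)) \<longlonglongrightarrow> integral\<^sup>L R (indicator A)"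
        by (rule integral_dominated_convergence[where w = "\<lambda>_. 1"])
           (use meas range lim measurable_cong_sets[OF sR refl] in auto)
      then show ?thesis using sets_eq_imp_space_eq[OF sR] by simp
    qed
    have "integral\<^sup>L P (\<phi> n) = integral\<^sup>L Q (\<phi> n)" for n
      by (rule eq[OF lip range])
    then show ?thesis
      using conv[OF assms(1) sets(1)] conv[OF assms(2) sets(2)] LIMSEQ_unique by simp
  qed simp
  show ?thesis
  proof (rule measure_eqI_generator_eq[where E = "Collect closed" and \<Omega> = UNIV and A = "\<lambda>_. UNIV"])
    show "Int_stable (Collect closed :: 'b set set)" by (auto simp: Int_stable_def)
    show "emeasure P X = emeasure Q X" if "X \<in> Collect closed" for X
      using closed[of X] that by (simp add: P.emeasure_eq_measure Q.emeasure_eq_measure)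
    have "sets (borel :: 'b measure) = sigma_sets UNIV (Collect closed)"
      unfolding borel_eq_closed by simp
    then show "sets P = sigma_sets UNIV (Collect closed)" "sets Q = sigma_sets UNIV (Collect closed)"
      using sets by simp_all
  qed auto
qed

text \<open>The variance of \<open>\<bar>X\<bar>\<close> is non-negative.\<close>

lemma (in prob_space) expectation_abs_le_sqrt:
  fixes X :: "'a \<Rightarrow> real"
  assumes X: "X \<in> borel_measurable M" "integrable M (\<lambda>x. (X x)\<^sup>2)"
  shows "expectation (\<lambda>x. \<bar>X x\<bar>) \<le> sqrt (expectation (\<lambda>x. (X x)\<^sup>2))"
proof -
  have i: "integrable M X" using square_integrable_imp_integrable[OF X] .
  have "0 \<le> expectation (\<lambda>x. \<bar>X x\<bar>\<^sup>2) - (expectation (\<lambda>x. \<bar>X x\<bar>))\<^sup>2"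
    using variance_positive[of "\<lambda>x. \<bar>X x\<bar>"] i X(2) by (subst (asm) variance_eq) auto
  then show ?thesis by (intro real_le_rsqrt) simp
qed

section \<open>Weak law of large numbers in mean\<close>

context prob_space
begin

text \<open>When the square is expanded, the mixed terms vanish by independence and centring; each
  of the \<open>n\<close> diagonal terms contributes the second moment.\<close>

lemma integral_PiM_sum_square:
  fixes h :: "'a \<Rightarrow> real"
  assumes h: "integrable M h" "integrable M (\<lambda>x. (h x)\<^sup>2)" "expectation h = 0"
  shows "integrable (PiM {..<n} (\<lambda>_. M)) (\<lambda>U. (\<Sum>i<n. h (U i))\<^sup>2)"
    and "(\<integral>U. (\<Sum>i<n. h (U i))\<^sup>2 \<partial>PiM {..<n} (\<lambda>_. M)) = real n * expectation (\<lambda>x. (h x)\<^sup>2)"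
proof -
  interpret product_sigma_finite "\<lambda>_::nat. M" ..
  \<comment> \<open>Writing \<open>h (U i) * h (U j)\<close> as a product over all coordinates makes
    the product formula for \<open>PiM\<close> applicable. Two separate factors treat
    \<open>i = j\<close> and \<open>i \<noteq> j\<close> uniformly.\<close>
  define f where "f i j k x = (if k = i then h x else 1) * (if k = j then h x else 1)" for i j k :: nat and x
  have f: "(\<Prod>k<n. f i j k (U k)) = h (U i) * h (U j)" if "i < n" "j < n" for i j U
    using that by (simp add: f_def prod.distrib)
  have int: "integrable M (f i j k)" for i j k
    unfolding f_def using h by (cases "k = i"; cases "k = j") (auto simp: power2_eq_square)
  have sq: "(\<Sum>i<n. h (U i))\<^sup>2 = (\<Sum>i<n. \<Sum>j<n. \<Prod>k<n. f i j k (U k))" for U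
    by (simp add: power2_eq_square sum_product f)
  have int': "integrable (PiM {..<n} (\<lambda>_. M)) (\<lambda>U. \<Prod>k<n. f i j k (U k))" for i j
    by (rule product_integrable_prod) (auto intro: int)
  show "integrable (PiM {..<n} (\<lambda>_. M)) (\<lambda>U. (\<Sum>i<n. h (U i))\<^sup>2)"
    unfolding sq by (intro Bochner_Integration.integrable_sum int')
  have val: "(\<integral>U. (\<Prod>k<n. f i j k (U k)) \<partial>PiM {..<n} (\<lambda>_. M)) = (if i = j then expectation (\<lambda>x. (h x)\<^sup>2) else 0)"
    if "i < n" "j < n" for i j
  proof -
    have "(\<integral>U. (\<Prod>k<n. f i j k (U k)) \<partial>PiM {..<n} (\<lambda>_. M)) = (\<Prod>k<n. expectation (f i j k))"
      by (rule product_integral_prod) (auto intro: int)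
    also have "\<dots> = (if i = j then expectation (\<lambda>x. (h x)\<^sup>2) else 0)"
    proof (cases "i = j")
      case True
      then have "expectation (f i j k) = (if k = i then expectation (\<lambda>x. (h x)\<^sup>2) else 1)" for k
        by (cases "k = i") (simp_all add: f_def[abs_def] power2_eq_square prob_space)
      then show ?thesis using that True by simp
    next
      case False
      then have "expectation (f i j i) = 0" using h(3) by (simp add: f_def[abs_def])
      then show ?thesis using that False by (auto intro!: prod_zero)
    qed
    finally show ?thesis .
  qed
  show "(\<integral>U. (\<Sum>i<n. h (U i))\<^sup>2 \<partial>PiM {..<n} (\<lambda>_. M)) = real n * expectation (\<lambda>x. (h x)\<^sup>2)"
    unfolding sq by (subst Bochner_Integration.integral_sum, use int' in simp)+ (simp add: val int')
qed

text \<open>The centred mean has second moment \<open>V / n\<close>, hence first absolute moment at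
  most \<open>sqrt (V / n)\<close>.\<close>

lemma sample_mean_tendsto:
  fixes g :: "'a \<Rightarrow> real" and n :: nat
  assumes g: "g \<in> borel_measurable M" "integrable M (\<lambda>x. (g x)\<^sup>2)"
  shows "n > 0 \<Longrightarrow> integrable (PiM {..<n} (\<lambda>_. M)) (\<lambda>U. \<bar>(\<Sum>i<n. g (U i)) / real n - expectation g\<bar>)"
    and "(\<lambda>n. \<integral>U. \<bar>(\<Sum>i<n. g (U i)) / real n - expectation g\<bar> \<partial>PiM {..<n} (\<lambda>_. M)) \<longlonglongrightarrow> 0"
proof -
  define h where "h x = g x - expectation g" for x
  have gi: "integrable M g" using square_integrable_imp_integrable[OF g] .
  have h: "integrable M h" "integrable M (\<lambda>x. (h x)\<^sup>2)" "expectation h = 0"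
    unfolding h_def power2_diff using g gi by (auto simp: prob_space)
  define V where "V = expectation (\<lambda>x. (h x)\<^sup>2)"
  let ?P = "\<lambda>n::nat. PiM {..<n} (\<lambda>_. M)"
  have eq: "(\<Sum>i<n. g (U i)) / real n - expectation g = (\<Sum>i<n. h (U i)) / real n" if "n > 0" for U and n :: nat
    using that by (simp add: h_def sum_subtractf field_simps)
  have [measurable]: "h \<in> borel_measurable M" using h(1) by auto
  have m [measurable]: "(\<lambda>U. (\<Sum>i<n. h (U i)) / real n) \<in> borel_measurable (?P n)" for n
    by measurable
  have sqi: "integrable (?P n) (\<lambda>U. ((\<Sum>i<n. h (U i)) / real n)\<^sup>2)"
    and sqv: "(\<integral>U. ((\<Sum>i<n. h (U i)) / real n)\<^sup>2 \<partial>?P n) = V / real n" for n :: nat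
    unfolding power_divide using integral_PiM_sum_square[OF h, of n]
    by (simp_all add: V_def power2_eq_square)
  have P: "prob_space (?P n)" for n by (intro prob_space_PiM) (rule prob_space_axioms)
  have bnd: "(\<integral>U. \<bar>(\<Sum>i<n. h (U i)) / real n\<bar> \<partial>?P n) \<le> sqrt (V / real n)" for n
    using prob_space.expectation_abs_le_sqrt[OF P m sqi] sqv by simp
  have int: "integrable (?P n) (\<lambda>U. \<bar>(\<Sum>i<n. h (U i)) / real n\<bar>)" for n
  proof -
    interpret P: prob_space "?P n" by (rule P)
    show ?thesis by (rule integrable_abs, rule P.square_integrable_imp_integrable[OF m sqi])
  qed
  show "integrable (?P n) (\<lambda>U. \<bar>(\<Sum>i<n. g (U i)) / real n - expectation g\<bar>)" if "n > 0"
    unfolding eq[OF that] by (rule int)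
  show "(\<lambda>n. \<integral>U. \<bar>(\<Sum>i<n. g (U i)) / real n - expectation g\<bar> \<partial>?P n) \<longlonglongrightarrow> 0"
  proof (rule tendsto_sandwich)
    show "\<forall>\<^sub>F n in sequentially. 0 \<le> (\<integral>U. \<bar>(\<Sum>i<n. g (U i)) / real n - expectation g\<bar> \<partial>?P n)"
      by simp
    show "\<forall>\<^sub>F n in sequentially. (\<integral>U. \<bar>(\<Sum>i<n. g (U i)) / real n - expectation g\<bar> \<partial>?P n) \<le> sqrt (V / real n)"
      using eventually_gt_at_top[of 0] by eventually_elim (simp only: eq bnd)
    have "(\<lambda>n. V / real n) \<longlonglongrightarrow> 0" by (rule lim_const_over_n)
    then show "(\<lambda>n. sqrt (V / real n)) \<longlonglongrightarrow> 0" using tendsto_real_sqrt by fastforce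
  qed simp
qed

end

text \<open>The product metric weights coordinates geometrically, so all but finitely many cost at
  most \<open>(1/2) ^ N\<close>. The maximum over the remaining ones is enlarged to a sum, which can
  be integrated term by term.\<close>

lemma dist_fun_le_sum:
  fixes x y :: "'i::countable \<Rightarrow> real"
  shows "dist x y \<le> 2 * (\<Sum>k\<le>N. \<bar>x (from_nat k) - y (from_nat k)\<bar>) + (1/2) ^ N"
proof -
  have "Max {dist (x (from_nat n)) (y (from_nat n)) |n. n \<le> N} \<le> (\<Sum>k\<le>N. \<bar>x (from_nat k) - y (from_nat k)\<bar>)"
  proof (rule Max.boundedI)
    fix a assume "a \<in> {dist (x (from_nat n)) (y (from_nat n)) |n. n \<le> N}"
    then obtain n where n: "n \<le> N" "a = \<bar>x (from_nat n) - y (from_nat n)\<bar>" by (auto simp: dist_real_def)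
    show "a \<le> (\<Sum>k\<le>N. \<bar>x (from_nat k) - y (from_nat k)\<bar>)"
      unfolding n(2) by (rule member_le_sum) (use n in auto)
  qed auto
  then show ?thesis using dist_fun_le_dist_first_terms[of x y N] by linarith
qed

lemma Lipschitz_borel_measurable:
  fixes \<phi> :: "'b::metric_space \<Rightarrow> real"
  assumes "\<And>x y. \<bar>\<phi> x - \<phi> y\<bar> \<le> C * dist x y"
  shows "\<phi> \<in> borel_measurable borel"
proof -
  \<comment> \<open>The sign of \<open>C\<close> is not given, but a constant in
    \<open>lipschitz_on\<close> must be non-negative.\<close>
  have "\<bar>C\<bar>-lipschitz_on UNIV \<phi>"
  proof (rule lipschitz_onI)
    fix x y
    show "dist (\<phi> x) (\<phi> y) \<le> \<bar>C\<bar> * dist x y"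
      unfolding dist_real_def using assms[of x y] mult_right_mono[OF abs_ge_self[of C] zero_le_dist[of x y]]
      by (rule order_trans)
  qed simp
  then show ?thesis
    by (intro borel_measurable_continuous_onI lipschitz_on_continuous_on)
qed

text \<open>Simultaneous law of large numbers for countably many functions of one sample: a
  Lipschitz test turns mean convergence of each coordinate into convergence of expectations.\<close>

lemma (in prob_space) Lipschitz_sample_mean_tendsto:
  fixes g :: "'i::countable \<Rightarrow> 'a \<Rightarrow> real" and \<phi> :: "('i \<Rightarrow> real) \<Rightarrow> real"
  assumes g: "\<And>j. g j \<in> borel_measurable M" "\<And>j. integrable M (\<lambda>x. (g j x)\<^sup>2)"
    and lip: "\<And>x y. \<bar>\<phi> x - \<phi> y\<bar> \<le> C * dist x y" and range: "\<And>x. \<phi> x \<in> {0..1}"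
  shows "(\<lambda>n. \<integral>U. \<phi> (\<lambda>j. (\<Sum>i<n. g j (U i)) / real n) \<partial>PiM {..<n} (\<lambda>_. M)) \<longlonglongrightarrow> \<phi> (\<lambda>j. expectation (g j))"
proof (rule LIMSEQ_I)
  fix e :: real assume e: "e > 0"
  note [measurable] = g(1)
  let ?P = "\<lambda>n::nat. PiM {..<n} (\<lambda>_. M)"
  define d where "d n j = (\<integral>U. \<bar>(\<Sum>i<n. g j (U i)) / real n - expectation (g j)\<bar> \<partial>?P n)" for n j
  \<comment> \<open>Adding 1 makes \<open>K\<close> strictly positive, so the thresholds below may
    divide by it.\<close>
  define K where "K = \<bar>C\<bar> + 1"
  have K: "K > 0" by (simp add: K_def)
  have m: "(\<lambda>U. \<phi> (\<lambda>j. (\<Sum>i<n. g j (U i)) / real n)) \<in> borel_measurable (?P n)" for n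
    by (rule measurable_compose[OF _ Lipschitz_borel_measurable[OF lip]])
       (rule measurable_coordinatewise_then_product, measurable)
  \<comment> \<open>Half of \<open>e\<close> pays for the tail \<open>K * (1/2) ^ N\<close>, the
    other half for \<open>2 * K\<close> times the sum of the first mean errors.\<close>
  obtain N where N: "(1/2) ^ N < e / (2 * K)"
    using real_arch_pow_inv[of "e / (2 * K)" "1/2"] e K by auto
  have "(\<lambda>n. \<Sum>k\<le>N. d n (from_nat k)) \<longlonglongrightarrow> (\<Sum>k\<le>N. 0)"
    unfolding d_def by (rule tendsto_sum) (rule sample_mean_tendsto(2)[OF g])
  then have "\<forall>\<^sub>F n in sequentially. (\<Sum>k\<le>N. d n (from_nat k)) < e / (4 * K)"
    using e K by (intro order_tendstoD) auto
  then obtain n0 where n0: "\<And>n. n \<ge> n0 \<Longrightarrow> (\<Sum>k\<le>N. d n (from_nat k)) < e / (4 * K)"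
    unfolding eventually_sequentially by blast
  have "norm ((\<integral>U. \<phi> (\<lambda>j. (\<Sum>i<n. g j (U i)) / real n) \<partial>?P n) - \<phi> (\<lambda>j. expectation (g j))) < e"
    if n: "n \<ge> max 1 n0" for n
  proof -
    interpret P: prob_space "?P n" by (intro prob_space_PiM) (rule prob_space_axioms)
    let ?F = "\<lambda>U. \<phi> (\<lambda>j. (\<Sum>i<n. g j (U i)) / real n)" and ?c = "\<phi> (\<lambda>j. expectation (g j))"
    let ?D = "\<lambda>U. \<Sum>k\<le>N. \<bar>(\<Sum>i<n. g (from_nat k) (U i)) / real n - expectation (g (from_nat k))\<bar>"
    have iF: "integrable (?P n) ?F"
      by (rule P.integrable_const_bound[where B = 1]) (use range m in auto)
    have iD: "integrable (?P n) (\<lambda>U. \<bar>(\<Sum>i<n. g j (U i)) / real n - expectation (g j)\<bar>)" for j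
      by (rule sample_mean_tendsto(1)) (use g n in auto)
    have "norm ((\<integral>U. ?F U \<partial>?P n) - ?c) = norm (\<integral>U. ?F U - ?c \<partial>?P n)"
      using iF by (simp add: P.prob_space)
    also have "\<dots> \<le> (\<integral>U. norm (?F U - ?c) \<partial>?P n)" by (rule integral_norm_bound)
    also have "\<dots> \<le> (\<integral>U. K * (2 * ?D U + (1/2) ^ N) \<partial>?P n)"
    proof (rule integral_mono)
      show "integrable (?P n) (\<lambda>U. norm (?F U - ?c))" using iF by simp
      show "integrable (?P n) (\<lambda>U. K * (2 * ?D U + (1/2) ^ N))" using iD by simp
      fix U
      have "norm (?F U - ?c) \<le> C * dist (\<lambda>j. (\<Sum>i<n. g j (U i)) / real n) (\<lambda>j. expectation (g j))"
        using lip by simp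
      also have "\<dots> \<le> K * dist (\<lambda>j. (\<Sum>i<n. g j (U i)) / real n) (\<lambda>j. expectation (g j))"
        by (intro mult_right_mono) (auto simp: K_def)
      also have "\<dots> \<le> K * (2 * ?D U + (1/2) ^ N)"
        using K by (intro mult_left_mono dist_fun_le_sum) auto
      finally show "norm (?F U - ?c) \<le> K * (2 * ?D U + (1/2) ^ N)" .
    qed
    also have "\<dots> = K * (2 * (\<Sum>k\<le>N. d n (from_nat k)) + (1/2) ^ N)"
      using iD by (simp add: P.prob_space d_def)
    also have "\<dots> < K * (2 * (e / (4 * K)) + e / (2 * K))"
      using n0[of n] n N K by (intro mult_strict_left_mono add_strict_mono) auto
    also have "\<dots> = e" using K by (simp add: field_simps)
    finally show ?thesis .
  qed
  then show "\<exists>no. \<forall>n\<ge>no. norm ((\<integral>U. \<phi> (\<lambda>j. (\<Sum>i<n. g j (U i)) / real n) \<partial>?P n) - \<phi> (\<lambda>j. expectation (g j))) < e"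
    by blast
qed

text \<open>The set \<open>X\<close> has full measure and carries the points at which the
  distributions are assumed to agree; it allows \<open>S\<close> to live on a larger space. A
  countable index makes measurability into the function space a coordinatewise matter.\<close>

lemma distr_integrals_eq:
  fixes T T' :: "'a \<Rightarrow> 'b \<Rightarrow> real" and h :: "'i::countable \<Rightarrow> 'b \<Rightarrow> real"
  assumes "prob_space M" "prob_space S"
    and meas: "case_prod T \<in> borel_measurable (M \<Otimes>\<^sub>M S)" "case_prod T' \<in> borel_measurable (M \<Otimes>\<^sub>M S)"
    and h: "\<And>j. h j \<in> borel_measurable S"
    and sq: "AE \<omega> in M. \<forall>j. integrable S (\<lambda>y. (T \<omega> y * h j y)\<^sup>2)"
            "AE \<omega> in M. \<forall>j. integrable S (\<lambda>y. (T' \<omega> y * h j y)\<^sup>2)"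
    and X: "AE y in S. y \<in> X"
    and fdd: "\<And>n ys. (\<And>i. i < n \<Longrightarrow> ys i \<in> X) \<Longrightarrow>
        distr M (PiM {..<n} (\<lambda>_. borel)) (\<lambda>\<omega>. \<lambda>i\<in>{..<n}. T \<omega> (ys i)) =
        distr M (PiM {..<n} (\<lambda>_. borel)) (\<lambda>\<omega>. \<lambda>i\<in>{..<n::nat}. T' \<omega> (ys i))"
  shows "distr M borel (\<lambda>\<omega> j. \<integral>y. T \<omega> y * h j y \<partial>S) = distr M borel (\<lambda>\<omega> j. \<integral>y. T' \<omega> y * h j y \<partial>S)"
proof -
  interpret M: prob_space M by fact
  interpret S: prob_space S by fact
  note [measurable] = h
  let ?P = "\<lambda>n::nat. PiM {..<n} (\<lambda>_. S)"
  have P: "prob_space (?P n)" for n by (intro prob_space_PiM) (rule S.prob_space_axioms)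
  define I where "I Z \<omega> = (\<lambda>j. \<integral>y. Z \<omega> y * h j y \<partial>S)" for Z :: "'a \<Rightarrow> 'b \<Rightarrow> real" and \<omega>
  have I [measurable]: "I Z \<in> borel_measurable M"
    if [measurable]: "case_prod Z \<in> borel_measurable (M \<Otimes>\<^sub>M S)" for Z
    unfolding I_def by (rule measurable_coordinatewise_then_product) measurable
  \<comment> \<open>For almost every \<open>\<omega>\<close> the inner sample expectation converges,
    and dominated convergence integrates this over \<open>M\<close>. The limit is stated with the
    two integrals exchanged, so that the inner one sees frozen sample points.\<close>
  have limit: "(\<lambda>n. \<integral>U. (\<integral>\<omega>. \<phi> (\<lambda>j. (\<Sum>i<n. Z \<omega> (U i) * h j (U i)) / real n) \<partial>M) \<partial>?P n) \<longlonglongrightarrow> (\<integral>\<omega>. \<phi> (I Z \<omega>) \<partial>M)"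
    if Z [measurable]: "case_prod Z \<in> borel_measurable (M \<Otimes>\<^sub>M S)"
      and Zsq: "AE \<omega> in M. \<forall>j. integrable S (\<lambda>y. (Z \<omega> y * h j y)\<^sup>2)"
      and lip: "\<And>x y. \<bar>\<phi> x - \<phi> y\<bar> \<le> C * dist x y" and range: "\<And>x. \<phi> x \<in> {0..1::real}" for Z \<phi> C
  proof -
    have [measurable]: "\<phi> \<in> borel_measurable borel" by (rule Lipschitz_borel_measurable[OF lip])
    define F where "F n \<omega> U = \<phi> (\<lambda>j. (\<Sum>i<n. Z \<omega> (U i) * h j (U i)) / real n)" for n :: nat and \<omega> U
    have F [measurable]: "case_prod (F n) \<in> borel_measurable (M \<Otimes>\<^sub>M ?P n)" for n
      unfolding F_def case_prod_beta
      by (rule measurable_compose[where g = \<phi> and N = borel]) (rule measurable_coordinatewise_then_product, measurable)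
    have F1: "norm (F n \<omega> U) \<le> 1" for n \<omega> U
      using range by (simp add: F_def)
    have swap: "(\<integral>U. (\<integral>\<omega>. F n \<omega> U \<partial>M) \<partial>?P n) = (\<integral>\<omega>. (\<integral>U. F n \<omega> U \<partial>?P n) \<partial>M)" for n
    proof -
      interpret P: prob_space "?P n" by (rule P)
      interpret MP: pair_prob_space M "?P n" ..
      show ?thesis
        by (rule MP.Fubini_integral, rule MP.integrable_const_bound[where B = 1]) (use F1 F in auto)
    qed
    have "(\<lambda>n. \<integral>\<omega>. (\<integral>U. F n \<omega> U \<partial>?P n) \<partial>M) \<longlonglongrightarrow> (\<integral>\<omega>. \<phi> (I Z \<omega>) \<partial>M)"
    proof (rule integral_dominated_convergence[where w = "\<lambda>_. 1"])
      show "(\<lambda>\<omega>. \<phi> (I Z \<omega>)) \<in> borel_measurable M" by measurable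
      show "(\<lambda>\<omega>. \<integral>U. F n \<omega> U \<partial>?P n) \<in> borel_measurable M" for n
      proof -
        interpret P: prob_space "?P n" by (rule P)
        show ?thesis by measurable
      qed
      show "AE \<omega> in M. norm (\<integral>U. F n \<omega> U \<partial>?P n) \<le> 1" for n
      proof (rule AE_I2)
        fix \<omega>
        interpret P: prob_space "?P n" by (rule P)
        have "norm (\<integral>U. F n \<omega> U \<partial>?P n) \<le> (\<integral>U. norm (F n \<omega> U) \<partial>?P n)" by (rule integral_norm_bound)
        also have "\<dots> \<le> (\<integral>U. 1 \<partial>?P n)"
          using F1 by (intro integral_mono') auto
        finally show "norm (\<integral>U. F n \<omega> U \<partial>?P n) \<le> 1" by (simp add: P.prob_space)
      qed
      show "AE \<omega> in M. (\<lambda>n. \<integral>U. F n \<omega> U \<partial>?P n) \<longlonglongrightarrow> \<phi> (I Z \<omega>)"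
        using Zsq AE_space
      proof eventually_elim
        case (elim \<omega>)
        then have [measurable]: "Z \<omega> \<in> borel_measurable S" using measurable_Pair2[OF Z] by simp
        show ?case unfolding F_def I_def
          using elim by (intro S.Lipschitz_sample_mean_tendsto[OF _ _ lip range]) auto
      qed
    qed simp
    then show ?thesis unfolding swap[symmetric] unfolding F_def .
  qed
  have eq: "(\<integral>U. (\<integral>\<omega>. \<phi> (\<lambda>j. (\<Sum>i<n. T \<omega> (U i) * h j (U i)) / real n) \<partial>M) \<partial>?P n) =
      (\<integral>U. (\<integral>\<omega>. \<phi> (\<lambda>j. (\<Sum>i<n. T' \<omega> (U i) * h j (U i)) / real n) \<partial>M) \<partial>?P n)"
    if lip: "\<And>x y. \<bar>\<phi> x - \<phi> y\<bar> \<le> C * dist x y" and range: "\<And>x. \<phi> x \<in> {0..1::real}" for \<phi> C n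
  proof (rule Bochner_Integration.integral_cong_AE)
    have [measurable]: "\<phi> \<in> borel_measurable borel" by (rule Lipschitz_borel_measurable[OF lip])
    interpret P: prob_space "?P n" by (rule P)
    have m: "(\<lambda>U. \<integral>\<omega>. \<phi> (\<lambda>j. (\<Sum>i<n. Z \<omega> (U i) * h j (U i)) / real n) \<partial>M) \<in> borel_measurable (?P n)"
      if Z [measurable]: "case_prod Z \<in> borel_measurable (M \<Otimes>\<^sub>M S)" for Z
      by (rule M.borel_measurable_lebesgue_integral, unfold case_prod_beta,
          rule measurable_compose[where g = \<phi> and N = borel], rule measurable_coordinatewise_then_product) measurable
    show "(\<lambda>U. \<integral>\<omega>. \<phi> (\<lambda>j. (\<Sum>i<n. T \<omega> (U i) * h j (U i)) / real n) \<partial>M) \<in> borel_measurable (?P n)"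
         "(\<lambda>U. \<integral>\<omega>. \<phi> (\<lambda>j. (\<Sum>i<n. T' \<omega> (U i) * h j (U i)) / real n) \<partial>M) \<in> borel_measurable (?P n)"
      by (intro m meas)+
    have "AE U in ?P n. U i \<in> X" if "i < n" for i
      by (rule AE_PiM_component) (use X that S.prob_space_axioms in auto)
    then have "AE U in ?P n. \<forall>i\<in>{..<n}. U i \<in> X"
      by (subst AE_finite_all) auto
    then show "AE U in ?P n. (\<integral>\<omega>. \<phi> (\<lambda>j. (\<Sum>i<n. T \<omega> (U i) * h j (U i)) / real n) \<partial>M) =
      (\<integral>\<omega>. \<phi> (\<lambda>j. (\<Sum>i<n. T' \<omega> (U i) * h j (U i)) / real n) \<partial>M)"
      using AE_space
    proof eventually_elim
      case (elim U)
      have US: "U i \<in> space S" if "i < n" for i using elim(2) that by (auto simp: space_PiM PiE_def Pi_def)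
      \<comment> \<open>With \<open>U\<close> frozen, the integrand depends on
        \<open>\<omega>\<close> only through the values at the points \<open>U i\<close>, so its
        expectation is an integral against a finite-dimensional distribution.\<close>
      define G where "G t = \<phi> (\<lambda>j. (\<Sum>i<n. t i * h j (U i)) / real n)" for t
      have [measurable]: "G \<in> borel_measurable (PiM {..<n} (\<lambda>_. borel))"
        unfolding G_def
        by (rule measurable_compose[where g = \<phi> and N = borel], rule measurable_coordinatewise_then_product) measurable
      have "(\<integral>\<omega>. \<phi> (\<lambda>j. (\<Sum>i<n. Z \<omega> (U i) * h j (U i)) / real n) \<partial>M) =
         integral\<^sup>L (distr M (PiM {..<n} (\<lambda>_. borel)) (\<lambda>\<omega>. \<lambda>i\<in>{..<n}. Z \<omega> (U i))) G"
        if Z: "case_prod Z \<in> borel_measurable (M \<Otimes>\<^sub>M S)" for Z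
      proof (subst integral_distr)
        show "(\<lambda>\<omega>. \<lambda>i\<in>{..<n}. Z \<omega> (U i)) \<in> measurable M (PiM {..<n} (\<lambda>_. borel))"
          by (rule measurable_restrict) (use measurable_Pair1[OF Z] US in auto)
      qed (simp_all add: G_def)
      from this[OF meas(1)] this[OF meas(2)] show ?case
        using fdd[of n U] elim by auto
    qed
  qed
  have "integral\<^sup>L (distr M borel (I T)) \<phi> = integral\<^sup>L (distr M borel (I T')) \<phi>"
    if lip: "\<And>x y. \<bar>\<phi> x - \<phi> y\<bar> \<le> C * dist x y" and range: "\<And>x. \<phi> x \<in> {0..1::real}" for \<phi> C
  proof -
    have "\<phi> \<in> borel_measurable borel" by (rule Lipschitz_borel_measurable[OF lip])
    then have d: "integral\<^sup>L (distr M borel (I Z)) \<phi> = (\<integral>\<omega>. \<phi> (I Z \<omega>) \<partial>M)"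
      if "case_prod Z \<in> borel_measurable (M \<Otimes>\<^sub>M S)" for Z
      by (intro integral_distr I that)
    show ?thesis
      unfolding d[OF meas(1)] d[OF meas(2)]
      using limit[OF meas(1) sq(1) lip range] limit[OF meas(2) sq(2) lip range]
      unfolding eq[OF lip range] by (rule LIMSEQ_unique)
  qed
  then have "distr M borel (I T) = distr M borel (I T')"
    by (intro measure_eqI_Lipschitz M.finite_measure_distr I meas) auto
  then show ?thesis by (simp only: I_def[abs_def])
qed

section \<open>The addition theorem for spherical harmonics\<close>

text \<open>The power \<open>u\<close> of \<open>z^2 - 1\<close> satisfies
  \<open>(z^2 - 1) u' = 2 l z u\<close>; differentiating this \<open>n\<close> times gives the
  identity. For \<open>n = 0\<close> the last coefficient vanishes, so the truncated index
  \<open>n - 1\<close> does no harm.\<close>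

lemma pderiv_funpow_rodrigues:
  fixes l n :: nat
  defines "u \<equiv> [:-1, 0, 1::real:] ^ l"
  shows "[:-1, 0, 1:] * (pderiv ^^ Suc n) u =
    smult (2 * (real l - real n)) ([:0, 1:] * (pderiv ^^ n) u)
    + smult (real n * (2 * real l - real n + 1)) ((pderiv ^^ (n - 1)) u)"
proof (induction n)
  case 0
  have "[:-1, 0, 1:] * pderiv u = smult (2 * real l) ([:0, 1:] * u)"
  proof (cases l)
    case 0
    then show ?thesis by (simp add: u_def)
  next
    case (Suc k)
    show ?thesis
      unfolding u_def Suc pderiv_power_Suc by (simp add: pderiv_pCons algebra_simps smult_add_left)
  qed
  then show ?case by simp
next
  case (Suc n)
  have [simp]: "pderiv ((pderiv ^^ (n - Suc 0)) u) = (pderiv ^^ n) u" if "n > 0"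
    using that by (cases n) auto
  define v where "v = (pderiv ^^ n) u"
  have "pderiv ([:-1, 0, 1:] * pderiv v) =
      smult (2 * (real l - real n)) (v + [:0, 1:] * pderiv v)
      + smult (real n * (2 * real l - real n + 1)) v"
    using arg_cong[OF Suc, of pderiv]
    by (cases "n = 0") (simp_all add: pderiv_add pderiv_mult pderiv_smult pderiv_pCons v_def smult_add_right)
  moreover have "pderiv ([:-1, 0, 1:] * pderiv v) = [:-1, 0, 1:] * pderiv (pderiv v) + smult 2 ([:0,1:] * pderiv v)"
    by (simp add: pderiv_mult pderiv_diff pderiv_pCons numeral_poly algebra_simps)
  ultimately have "[:-1, 0, 1:] * pderiv (pderiv v) = smult (2 * (real l - real n)) (v + [:0, 1:] * pderiv v)
      + smult (real n * (2 * real l - real n + 1)) v - smult 2 ([:0,1:] * pderiv v)"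
    by (simp add: algebra_simps)
  from arg_cong[OF this, of "\<lambda>p. poly p z" for z]
  have "poly ([:-1, 0, 1:] * (pderiv ^^ Suc (Suc n)) u) z =
      poly (smult (2 * (real l - real (Suc n))) ([:0, 1:] * (pderiv ^^ Suc n) u)
      + smult (real (Suc n) * (2 * real l - real (Suc n) + 1)) ((pderiv ^^ (Suc n - 1)) u)) z" for z
    by (simp add: v_def[symmetric] algebra_simps)
  then show ?case by (intro poly_eq_poly_eq_iff[THEN iffD1] ext)
qed

lemma pderiv_funpow_smult: "(pderiv ^^ n) (smult (c::real) p) = smult c ((pderiv ^^ n) p)"
  by (induction n) (simp_all add: pderiv_smult)

lemma pderiv_funpow_eq_0: "degree (p :: real poly) < n \<Longrightarrow> (pderiv ^^ n) p = 0"
proof (induction n arbitrary: p)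
  case (Suc n)
  show ?case
  proof (cases "degree p = 0")
    case True
    then show ?thesis by (simp add: funpow_Suc_right pderiv_eq_0_iff[THEN iffD2] del: funpow.simps)
  next
    case False
    then have "degree (pderiv p) < n" using Suc.prems by (simp add: degree_pderiv)
    then show ?thesis using Suc.IH by (simp add: funpow_Suc_right del: funpow.simps)
  qed
qed simp

text \<open>This is the Rodrigues identity at \<open>n = m + l\<close>, negated and rescaled. It
  relates three neighbouring orders and is the source of the ladder coefficient
  \<open>(l + m) (l - m + 1)\<close>.\<close>

lemma poly_legendre_recurrence:
  assumes "m > 0"
  shows "(1 - z\<^sup>2) * poly ((pderiv ^^ Suc m) (legendre_poly l)) z =
     2 * real m * z * poly ((pderiv ^^ m) (legendre_poly l)) z
     - (real l + real m) * (real l - real m + 1) * poly ((pderiv ^^ (m - 1)) (legendre_poly l)) z"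
proof -
  define c :: real where "c = 1 / (2 ^ l * fact l)"
  define u :: "real poly" where "u = [:-1, 0, 1:] ^ l"
  have P: "(pderiv ^^ k) (legendre_poly l) = smult c ((pderiv ^^ (k + l)) u)" for k
    unfolding legendre_poly_def c_def[symmetric] u_def[symmetric] pderiv_funpow_smult funpow_add by simp
  have [simp]: "l + (m - Suc 0) = l + m - Suc 0" using assms by simp
  have "poly ([:-1, 0, 1:] * (pderiv ^^ Suc (m + l)) u) z =
     poly (smult (2 * (real l - real (m + l))) ([:0, 1:] * (pderiv ^^ (m + l)) u)
    + smult (real (m + l) * (2 * real l - real (m + l) + 1)) ((pderiv ^^ (m + l - 1)) u)) z"
    unfolding u_def pderiv_funpow_rodrigues ..
  from arg_cong[OF this, of "\<lambda>t. c * t"] show ?thesis unfolding P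
    by (simp add: algebra_simps power2_eq_square)
qed

text \<open>\<open>(z^2 - 1)^l\<close> has degree \<open>2 * l\<close>, and \<open>2 * l + 1\<close>
  derivatives kill it. The ladder therefore stops at order \<open>l\<close>.\<close>

lemma pderiv_funpow_legendre_eq_0: "(pderiv ^^ Suc l) (legendre_poly l) = 0"
proof -
  have "degree ([:-1, 0, 1::real:] ^ l) = 2 * l" by (subst degree_power_eq) auto
  then have "(pderiv ^^ (Suc l + l)) ([:-1, 0, 1::real:] ^ l) = 0"
    by (intro pderiv_funpow_eq_0) simp
  then show ?thesis
    unfolding legendre_poly_def pderiv_funpow_smult by (simp add: funpow_add)
qed

text \<open>The harmonic of order \<open>m \<ge> 0\<close> stripped of its normalising constant and
  Condon-Shortley sign; both are real and enter the kernel only squared.\<close>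

definition plain_harm :: "nat \<Rightarrow> nat \<Rightarrow> real^3 \<Rightarrow> complex" where
  "plain_harm l m x = of_real (poly ((pderiv ^^ m) (legendre_poly l)) (x $ 3)) * Complex (x $ 1) (x $ 2) ^ m"

text \<open>The reproducing kernel of the degree-\<open>l\<close> harmonics.\<close>

definition zonal :: "nat \<Rightarrow> real^3 \<Rightarrow> real^3 \<Rightarrow> complex" where
  "zonal l x y = (\<Sum>m\<in>{-int l..int l}. sph_harm l m x * cnj (sph_harm l m y))"

text \<open>The kernel without the factor \<open>(2 l + 1) / (4 pi)\<close>; the 2 comes from
  merging the conjugate terms of orders \<open>m\<close> and \<open>-m\<close>.\<close>

definition zonal_real :: "nat \<Rightarrow> real^3 \<Rightarrow> real^3 \<Rightarrow> real" where
  "zonal_real l x y = Re (plain_harm l 0 x * cnj (plain_harm l 0 y)) +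
     2 * (\<Sum>m=1..l. fact (l - m) / fact (l + m) * Re (plain_harm l m x * cnj (plain_harm l m y)))"

lemma sph_harm_nonneg_mult:
  "sph_harm_nonneg l m x * cnj (sph_harm_nonneg l m y) =
    of_real ((2 * real l + 1) / (4 * pi)) *
    (of_real (fact (l - m) / fact (l + m)) * (plain_harm l m x * cnj (plain_harm l m y)))"
proof -
  define r where "r = (2 * real l + 1) / (4 * pi) * (fact (l - m) / fact (l + m))"
  have r: "complex_of_real (sqrt r) * complex_of_real (sqrt r) = of_real r"
    by (simp add: r_def flip: of_real_mult)
  have s: "complex_of_real ((-1) ^ m) * complex_of_real ((-1) ^ m) = 1"
    by (simp flip: power_mult_distrib)
  have "sph_harm_nonneg l m x * cnj (sph_harm_nonneg l m y) =
     (complex_of_real (sqrt r) * complex_of_real (sqrt r)) *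
     (complex_of_real ((-1) ^ m) * complex_of_real ((-1) ^ m)) *
     (plain_harm l m x * cnj (plain_harm l m y))"
    unfolding sph_harm_nonneg_def plain_harm_def r_def[symmetric] of_real_mult complex_cnj_mult complex_cnj_complex_of_real
    by (simp only: mult_ac)
  then have "sph_harm_nonneg l m x * cnj (sph_harm_nonneg l m y) = of_real r * (plain_harm l m x * cnj (plain_harm l m y))"
    by (simp only: r s mult_1_right)
  then show ?thesis unfolding r_def by simp
qed

lemma sum_symmetric_int:
  "(\<Sum>m\<in>{-int l..int l}. f m) = f 0 + (\<Sum>m=1..l. f (int m) + f (- int m))"
proof -
  have "{-int l..int l} = insert 0 (int ` {1..l} \<union> (\<lambda>m. - int m) ` {1..l})"
  proof (intro equalityI subsetI)
    fix m assume m: "m \<in> {-int l..int l}"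
    consider "m = 0" | "m > 0" | "m < 0" by linarith
    then show "m \<in> insert 0 (int ` {1..l} \<union> (\<lambda>m. - int m) ` {1..l})"
    proof cases
      case 2
      then have "m = int (nat m)" "nat m \<in> {1..l}" using m by auto
      then show ?thesis by blast
    next
      case 3
      then have "m = - int (nat (-m))" "nat (-m) \<in> {1..l}" using m by auto
      then show ?thesis by blast
    qed simp
  qed auto
  moreover have "sum f (insert 0 (int ` {1..l} \<union> (\<lambda>m. - int m) ` {1..l})) =
     f 0 + (sum f (int ` {1..l}) + sum f ((\<lambda>m. - int m) ` {1..l}))"
  proof -
    have "sum f (int ` {1..l} \<union> (\<lambda>m. - int m) ` {1..l}) = sum f (int ` {1..l}) + sum f ((\<lambda>m. - int m) ` {1..l})"
      by (rule sum.union_disjoint) auto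
    then show ?thesis by (subst sum.insert) auto
  qed
  ultimately show ?thesis
    by (simp add: sum.reindex inj_on_def sum.distrib)
qed

text \<open>Order \<open>-m\<close> is the conjugate of order \<open>m\<close> up to a sign that
  squares to 1, so the two terms add up to twice a real part.\<close>

lemma zonal_eq_zonal_real:
  "zonal l x y = of_real ((2 * real l + 1) / (4 * pi) * zonal_real l x y)"
proof -
  define C where "C = complex_of_real ((2 * real l + 1) / (4 * pi))"
  have neg: "sph_harm l (- int m) x * cnj (sph_harm l (- int m) y) =
    cnj (sph_harm_nonneg l m x * cnj (sph_harm_nonneg l m y))" if "m \<ge> 1" for m
    using that by (simp add: sph_harm_def)
  have "zonal l x y = C * (plain_harm l 0 x * cnj (plain_harm l 0 y)) +
     (\<Sum>m=1..l. C * (of_real (fact (l - m) / fact (l + m)) *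
        (plain_harm l m x * cnj (plain_harm l m y) + cnj (plain_harm l m x * cnj (plain_harm l m y)))))"
    unfolding zonal_def sum_symmetric_int
  proof (intro arg_cong2[where f="(+)"] sum.cong refl)
    show "sph_harm l 0 x * cnj (sph_harm l 0 y) = C * (plain_harm l 0 x * cnj (plain_harm l 0 y))"
      using sph_harm_nonneg_mult[of l 0 x y] by (simp add: sph_harm_def C_def)
    fix m assume "m \<in> {1..l}"
    then have m: "m \<ge> 1" by simp
    show "sph_harm l (int m) x * cnj (sph_harm l (int m) y) + sph_harm l (- int m) x * cnj (sph_harm l (- int m) y)
       = C * (of_real (fact (l - m) / fact (l + m)) *
        (plain_harm l m x * cnj (plain_harm l m y) + cnj (plain_harm l m x * cnj (plain_harm l m y))))"
      unfolding neg[OF m] sph_harm_nonneg_mult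
      using sph_harm_nonneg_mult[of l m x y] by (simp add: sph_harm_def C_def distrib_left)
  qed
  also have "\<dots> = C * of_real (zonal_real l x y)"
    unfolding zonal_real_def complex_add_cnj
    by (simp add: sum_distrib_left distrib_left mult_ac complex_eq_iff[of "plain_harm l 0 x * _"] plain_harm_def[of l 0])
  finally show ?thesis by (simp add: C_def)
qed

text \<open>Along a rotation about the first axis the functions \<open>plain_harm l m\<close> evolve by the ladder
  equations assumed here; the weights make the derivative of \<open>zonal_real\<close> telescope.\<close>

lemma zonal_flow_derivative_eq_0:
  fixes F G F' G' :: "nat \<Rightarrow> complex" and l :: nat
  assumes F': "\<And>m. m > 0 \<Longrightarrow> F' m = - \<i> / 2 * (F (Suc m) + of_real ((real l + real m) * (real l - real m + 1)) * F (m - 1))"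
    and G': "\<And>m. m > 0 \<Longrightarrow> G' m = - \<i> / 2 * (G (Suc m) + of_real ((real l + real m) * (real l - real m + 1)) * G (m - 1))"
    and F0: "Im (F 0) = 0" "F' 0 = of_real (Im (F 1))" and G0: "Im (G 0) = 0" "G' 0 = of_real (Im (G 1))"
    and top: "F (Suc l) = 0" "G (Suc l) = 0"
  shows "Re (F' 0 * cnj (G 0) + F 0 * cnj (G' 0)) +
     2 * (\<Sum>m=1..l. fact (l - m) / fact (l + m) * Re (F' m * cnj (G m) + F m * cnj (G' m))) = 0"
proof -
  \<comment> \<open>The flux from order \<open>m\<close> to order \<open>m + 1\<close>. The weights
    satisfy \<open>w m * (l + m) * (l - m + 1) = w (m - 1)\<close> (fact \<open>w\<close> below), so
    order \<open>m\<close> contributes outflow minus inflow. \<open>E l\<close> vanishes at the top,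
    and the order-0 term equals \<open>E 0\<close>.\<close>
  define E where "E m = fact (l - m) / fact (l + m) * Im (F (Suc m) * cnj (G m) - F m * cnj (G (Suc m)))" for m
  have "2 * (fact (l - m) / fact (l + m) * Re (F' m * cnj (G m) + F m * cnj (G' m))) = E m - E (m - 1)"
    if m: "m \<in> {Suc 0..l}" for m
  proof -
    obtain k where k: "m = Suc k" using m by (cases m) auto
    have w: "fact (l - m) / fact (l + m) * ((real l + real m) * (real l - real m + 1)) = (fact (l - k) / fact (l + k) :: real)"
    proof -
      have 1: "(fact (l - k) :: real) = (real l - real m + 1) * fact (l - m)"
        using m k by (subst fact_reduce) (auto simp: of_nat_diff)
      have 2: "(fact (l + m) :: real) = (real l + real m) * fact (l + k)"
        unfolding k by simp
      have 3: "p / (r * q) * (r * r') = r' * p / q" if "r \<noteq> 0" for p q r r' :: real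
        using that by simp
      show ?thesis unfolding 1 2 by (rule 3) (use m in simp)
    qed
    define v :: real where "v = fact (l - m) / fact (l + m)"
    define c where "c = (real l + real m) * (real l - real m + 1)"
    have Ek: "E k = v * c * Im (F m * cnj (G k) - F k * cnj (G m))"
      unfolding E_def w[symmetric] v_def c_def k ..
    have Em: "E m = v * Im (F (Suc m) * cnj (G m) - F m * cnj (G (Suc m)))"
      unfolding E_def v_def ..
    have F'm: "F' m = - \<i> / 2 * (F (Suc m) + of_real c * F k)"
      and G'm: "G' m = - \<i> / 2 * (G (Suc m) + of_real c * G k)"
      using F'[of m] G'[of m] unfolding c_def k by simp_all
    have m1: "m - 1 = k" using k by simp
    show ?thesis unfolding m1 Ek Em F'm G'm v_def[symmetric] by (simp add: field_simps)
  qed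
  then have "2 * (\<Sum>m=1..l. fact (l - m) / fact (l + m) * Re (F' m * cnj (G m) + F m * cnj (G' m)))
     = (\<Sum>m=Suc 0..l. E m - E (m - 1))"
    unfolding sum_distrib_left by (auto intro!: sum.cong)
  also have "\<dots> = E l - E 0" by (rule sum_telescope'') simp
  also have "E l = 0" by (simp add: E_def top)
  finally show ?thesis using F0 G0 by (simp add: E_def)
qed

section \<open>Rotations about the first and third coordinate axes\<close>

definition rot_x :: "real \<Rightarrow> real^3 \<Rightarrow> real^3" where
  "rot_x t x = vector [x $ 1, cos t * x $ 2 - sin t * x $ 3, sin t * x $ 2 + cos t * x $ 3]"

definition rot_z :: "real \<Rightarrow> real^3 \<Rightarrow> real^3" where
  "rot_z t x = vector [cos t * x $ 1 - sin t * x $ 2, sin t * x $ 1 + cos t * x $ 2, x $ 3]"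

lemma norm_vec3: "(norm (x::real^3))\<^sup>2 = (x $ 1)\<^sup>2 + (x $ 2)\<^sup>2 + (x $ 3)\<^sup>2"
  unfolding power2_norm_eq_inner inner_vec_def sum_3 by (simp add: power2_eq_square)

lemma inner_rot_x: "rot_x t x \<bullet> rot_x t y = x \<bullet> y"
proof -
  define c s where "c = cos t" and "s = sin t"
  have "rot_x t x \<bullet> rot_x t y = x $ 1 * y $ 1 + (c * c + s * s) * (x $ 2 * y $ 2 + x $ 3 * y $ 3)"
    unfolding inner_vec_def sum_3 rot_x_def c_def[symmetric] s_def[symmetric] by (simp add: algebra_simps)
  moreover have "c * c + s * s = 1" by (simp add: c_def s_def)
  ultimately show ?thesis by (simp add: inner_vec_def sum_3)
qed

lemma inner_rot_z: "rot_z t x \<bullet> rot_z t y = x \<bullet> y"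
proof -
  define c s where "c = cos t" and "s = sin t"
  have "rot_z t x \<bullet> rot_z t y = x $ 3 * y $ 3 + (c * c + s * s) * (x $ 1 * y $ 1 + x $ 2 * y $ 2)"
    unfolding inner_vec_def sum_3 rot_z_def c_def[symmetric] s_def[symmetric] by (simp add: algebra_simps)
  moreover have "c * c + s * s = 1" by (simp add: c_def s_def)
  ultimately show ?thesis by (simp add: inner_vec_def sum_3)
qed

lemma norm_rot_x [simp]: "norm (rot_x t x) = norm x"
  by (simp add: norm_eq_sqrt_inner inner_rot_x)

lemma norm_rot_z [simp]: "norm (rot_z t x) = norm x"
  by (simp add: norm_eq_sqrt_inner inner_rot_z)

text \<open>The rotation multiplies order \<open>m\<close> by the phase \<open>cis t ^ m\<close>,
  which cancels against its conjugate.\<close>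

lemma zonal_real_rot_z: "zonal_real l (rot_z t x) (rot_z t y) = zonal_real l x y"
proof -
  have "Complex (rot_z t x $ 1) (rot_z t x $ 2) = cis t * Complex (x $ 1) (x $ 2)" for x
    by (simp add: rot_z_def complex_eq_iff)
  then have S: "plain_harm l m (rot_z t x) = cis t ^ m * plain_harm l m x" for m x
    by (simp add: plain_harm_def rot_z_def power_mult_distrib)
  have "cis t ^ m * cnj (cis t ^ m) = 1" for m
    by (simp add: cis_cnj cis_mult flip: power_mult_distrib)
  then have "plain_harm l m (rot_z t x) * cnj (plain_harm l m (rot_z t y)) = plain_harm l m x * cnj (plain_harm l m y)" for m
    unfolding S complex_cnj_mult by (metis (no_types, lifting) mult.left_commute mult.assoc mult_1)
  then show ?thesis unfolding zonal_real_def by simp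
qed

text \<open>With \<open>z\<close> the height, \<open>b\<close> the second coordinate and
  \<open>w\<close> the horizontal part as a complex number, the flow is \<open>z' = b\<close>,
  \<open>w' = - \<i> z\<close>. The Legendre recurrence rewrites the resulting derivative in terms
  of orders \<open>m + 1\<close> and \<open>m - 1\<close>: the first-axis generator as half the sum
  of the two ladder operators.\<close>

lemma plain_harm_rot_x_derivative:
  fixes x :: "real^3" and l m :: nat and t :: real
  assumes x: "norm x = 1"
  defines "F \<equiv> \<lambda>m t. plain_harm l m (rot_x t x)"
  shows "m > 0 \<Longrightarrow> (F m has_vector_derivative
      (- \<i> / 2 * (F (Suc m) t + of_real ((real l + real m) * (real l - real m + 1)) * F (m - 1) t))) (at t)"
    and "(F 0 has_vector_derivative (of_real (Im (F 1 t)))) (at t)"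
proof -
  define z where "z t = rot_x t x $ 3" for t
  define b where "b t = rot_x t x $ 2" for t
  define w where "w t = Complex (rot_x t x $ 1) (rot_x t x $ 2)" for t
  define Q where "Q m z = poly ((pderiv ^^ m) (legendre_poly l)) z" for m z
  have F: "F m = (\<lambda>t. of_real (Q m (z t)) * w t ^ m)" for m
    by (simp add: F_def plain_harm_def Q_def z_def w_def)
  have dz: "(z has_real_derivative b t) (at t)"
    unfolding z_def b_def rot_x_def by (auto intro!: derivative_eq_intros)
  have dQ: "((\<lambda>t. Q m (z t)) has_real_derivative Q (Suc m) (z t) * b t) (at t)" for m
    unfolding Q_def using DERIV_chain2[OF poly_DERIV dz] by simp
  have dQ': "((\<lambda>t. complex_of_real (Q m (z t))) has_vector_derivative of_real (Q (Suc m) (z t) * b t)) (at t)" for m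
    using dQ[of m] by (simp add: has_vector_derivative_complex_iff has_real_derivative_iff_has_vector_derivative flip: of_real_mult)
  have dw: "(w has_vector_derivative - \<i> * of_real (z t)) (at t)"
    unfolding w_def z_def rot_x_def
    by (auto simp: has_vector_derivative_complex_iff intro!: derivative_eq_intros)
  have dwm: "((\<lambda>t. w t ^ m) has_vector_derivative of_nat m * (- \<i> * of_real (z t)) * w t ^ (m - 1)) (at t)" for m
  proof -
    have "((\<lambda>z. z ^ m) has_field_derivative of_nat m * w t ^ (m - 1)) (at (w t))"
      by (auto intro!: derivative_eq_intros)
    from field_vector_diff_chain_at[OF dw this] show ?thesis
      by (simp add: o_def mult_ac)
  qed
  have d: "(F m has_vector_derivative (of_real (Q m (z t)) * (of_nat m * (- \<i> * of_real (z t)) * w t ^ (m - 1))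
     + of_real (Q (Suc m) (z t) * b t) * w t ^ m)) (at t)" for m
    unfolding F by (rule has_vector_derivative_mult[OF dQ' dwm])
  \<comment> \<open>On the unit sphere the factor \<open>1 - z^2\<close> of the recurrence is
    \<open>w * cnj w\<close>. Combined with \<open>w - cnj w = 2 \<i> b\<close> it produces the term
    with \<open>b\<close>.\<close>
  have sph: "1 - (z t)\<^sup>2 = Re (w t * cnj (w t))"
    using norm_vec3[of "rot_x t x"] x by (simp add: z_def w_def power2_eq_square algebra_simps)
  then have sph: "of_real (1 - (z t)\<^sup>2) = w t * cnj (w t)"
    by (simp add: complex_eq_iff)
  have wb: "w t - cnj (w t) = 2 * \<i> * of_real (b t)"
    by (simp add: w_def b_def complex_eq_iff)
  show "(F 0 has_vector_derivative (of_real (Im (F 1 t)))) (at t)"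
    using d[of 0] by (simp add: F w_def b_def)
  assume m: "m > 0"
  then obtain k where k: "m = Suc k" by (cases m) auto
  define c where "c = (real l + real m) * (real l - real m + 1)"
  have rec: "of_real c * of_real (Q k (z t)) =
    2 * of_nat m * of_real (z t) * complex_of_real (Q m (z t)) - w t * cnj (w t) * of_real (Q (Suc m) (z t))"
  proof -
    have "c * Q k (z t) = 2 * real m * z t * Q m (z t) - (1 - (z t)\<^sup>2) * Q (Suc m) (z t)"
      using poly_legendre_recurrence[OF m, of "z t" l] unfolding Q_def c_def by (simp add: k)
    from arg_cong[OF this, of complex_of_real] show ?thesis
      by (simp flip: sph)
  qed
  have "- \<i> / 2 * (F (Suc m) t + of_real c * F (m - 1) t) =
    - \<i> / 2 * (of_real (Q (Suc m) (z t)) * w t * w t + of_real c * of_real (Q k (z t))) * w t ^ k"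
    by (simp add: F k algebra_simps)
  also have "\<dots> = - \<i> / 2 * (of_real (Q (Suc m) (z t)) * w t * (w t - cnj (w t)) + 2 * of_nat m * of_real (z t) * of_real (Q m (z t))) * w t ^ k"
    unfolding rec by (simp add: algebra_simps)
  also have "\<dots> = of_real (Q m (z t)) * (of_nat m * (- \<i> * of_real (z t)) * w t ^ (m - 1))
     + of_real (Q (Suc m) (z t) * b t) * w t ^ m"
    unfolding wb by (simp add: k algebra_simps)
  finally show "(F m has_vector_derivative
      (- \<i> / 2 * (F (Suc m) t + of_real ((real l + real m) * (real l - real m + 1)) * F (m - 1) t))) (at t)"
    using d[of m] unfolding c_def by simp
qed

text \<open>The ladder equations hold along the orbits of both points, so the derivative in
  \<open>t\<close> telescopes to 0.\<close>

lemma zonal_real_rot_x: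
  assumes x: "norm x = 1" and y: "norm y = 1"
  shows "zonal_real l (rot_x t x) (rot_x t y) = zonal_real l x y"
proof -
  define F where "F m t = plain_harm l m (rot_x t x)" for m t
  define G where "G m t = plain_harm l m (rot_x t y)" for m t
  \<comment> \<open>Order 0 has no lower neighbour among the natural numbers. A neighbour
    contributing \<open>- cnj (H 1 t)\<close> would turn the ladder formula into
    \<open>Im (H 1 t)\<close>, the value used here.\<close>
  define D where "D H m t = (if m = 0 then of_real (Im (H 1 t)) else 
    - \<i> / 2 * (H (Suc m) t + of_real ((real l + real m) * (real l - real m + 1)) * H (m - 1) t))" 
    for H :: "nat \<Rightarrow> real \<Rightarrow> complex" and m :: nat and t
  have dF: "(F m has_vector_derivative D F m t) (at t)" for m t
    using plain_harm_rot_x_derivative(1)[where m = m and l = l and t = t, OF x]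
      plain_harm_rot_x_derivative(2)[where l = l and t = t, OF x] by (cases "m = 0") (auto simp: F_def[abs_def] D_def)
  have dG: "(G m has_vector_derivative D G m t) (at t)" for m t
    using plain_harm_rot_x_derivative(1)[where m = m and l = l and t = t, OF y]
      plain_harm_rot_x_derivative(2)[where l = l and t = t, OF y] by (cases "m = 0") (auto simp: G_def[abs_def] D_def)
  have dRe: "((\<lambda>t. Re (F m t * cnj (G m t))) has_real_derivative Re (D F m t * cnj (G m t) + F m t * cnj (D G m t))) (at t)" for m t
  proof -
    have "((\<lambda>t. F m t * cnj (G m t)) has_vector_derivative (F m t * cnj (D G m t) + D F m t * cnj (G m t))) (at t)"
      by (intro has_vector_derivative_mult dF has_vector_derivative_cnj dG)
    then show ?thesis by (simp only: has_vector_derivative_complex_iff add.commute)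
  qed
  have "((\<lambda>t. zonal_real l (rot_x t x) (rot_x t y)) has_real_derivative 0) (at t)" for t
  proof -
    have "((\<lambda>t. zonal_real l (rot_x t x) (rot_x t y)) has_real_derivative
      Re (D F 0 t * cnj (G 0 t) + F 0 t * cnj (D G 0 t)) +
      2 * (\<Sum>m=1..l. fact (l - m) / fact (l + m) * Re (D F m t * cnj (G m t) + F m t * cnj (D G m t)))) (at t)"
      unfolding zonal_real_def F_def[symmetric] G_def[symmetric]
      by (intro DERIV_add DERIV_cmult DERIV_sum dRe)
    also have "Re (D F 0 t * cnj (G 0 t) + F 0 t * cnj (D G 0 t)) +
      2 * (\<Sum>m=1..l. fact (l - m) / fact (l + m) * Re (D F m t * cnj (G m t) + F m t * cnj (D G m t))) = 0"
      by (rule zonal_flow_derivative_eq_0[of "\<lambda>m. D F m t" "\<lambda>m. F m t" l "\<lambda>m. D G m t" "\<lambda>m. G m t"])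
         (simp_all add: D_def F_def G_def plain_harm_def pderiv_funpow_legendre_eq_0 del: funpow.simps(2))
    finally show ?thesis .
  qed
  then have "zonal_real l (rot_x t x) (rot_x t y) = zonal_real l (rot_x 0 x) (rot_x 0 y)"
    using DERIV_isconst_all[of "\<lambda>t. zonal_real l (rot_x t x) (rot_x t y)"] by blast
  moreover have "rot_x 0 x = x" for x by (simp add: rot_x_def vec_eq_iff forall_3)
  ultimately show ?thesis by simp
qed

lemma rotate_pair_to_0:
  obtains t :: real where "cos t * a - sin t * b = 0" "sin t * a + cos t * b = sqrt (a\<^sup>2 + b\<^sup>2)"
proof (cases "a\<^sup>2 + b\<^sup>2 = 0")
  case True
  then have "a = 0" "b = 0" by (simp_all add: sum_power2_eq_zero_iff)
  then show ?thesis using that[of 0] by simp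
next
  case False
  define r where "r = sqrt (a\<^sup>2 + b\<^sup>2)"
  have r: "r > 0" "r\<^sup>2 = a\<^sup>2 + b\<^sup>2"
    using False by (auto simp: r_def order_less_le)
  have "(b / r)\<^sup>2 + (a / r)\<^sup>2 = 1" using r False by (simp add: power_divide add_divide_distrib[symmetric] add.commute)
  then obtain t where t: "b / r = cos t" "a / r = sin t" using sincos_total_2pi by metis
  show ?thesis
  proof (rule that[of t])
    show "cos t * a - sin t * b = 0" by (simp add: t[symmetric])
    have "sin t * a + cos t * b = (a\<^sup>2 + b\<^sup>2) / r"
      by (simp add: t[symmetric] power2_eq_square add_divide_distrib)
    also have "\<dots> = r" unfolding r(2)[symmetric] using r(1) by (simp add: power2_eq_square)
    finally show "sin t * a + cos t * b = sqrt (a\<^sup>2 + b\<^sup>2)" by (simp add: r_def)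
  qed
qed

text \<open>Both sides are invariant under the two axis rotations, so \<open>x\<close> may be taken
  to be the north pole. There the horizontal part vanishes and only order 0 remains.\<close>

lemma addition_theorem:
  assumes x: "norm x = 1" and y: "norm y = 1"
  shows "zonal_real l x y = poly (legendre_poly l) 1 * poly (legendre_poly l) (x \<bullet> y)"
proof -
  \<comment> \<open>The rotation by \<open>s\<close> about the third axis clears the first
    coordinate of \<open>x\<close>; the later one by \<open>t\<close> about the first axis clears
    the second. A unit vector is then left with third coordinate 1, the square root fixing the
    sign.\<close>
  obtain s where s: "cos s * x $ 1 - sin s * x $ 2 = 0" "sin s * x $ 1 + cos s * x $ 2 = sqrt ((x $ 1)\<^sup>2 + (x $ 2)\<^sup>2)"
    by (rule rotate_pair_to_0)
  define x' where "x' = rot_z s x"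
  define y' where "y' = rot_z s y"
  obtain t where t: "cos t * x' $ 2 - sin t * x' $ 3 = 0" "sin t * x' $ 2 + cos t * x' $ 3 = sqrt ((x' $ 2)\<^sup>2 + (x' $ 3)\<^sup>2)"
    by (rule rotate_pair_to_0)
  have x'1: "x' $ 1 = 0" using s by (simp add: x'_def rot_z_def)
  have n: "norm x' = 1" "norm y' = 1" using x y by (simp_all add: x'_def y'_def)
  then have "sqrt ((x' $ 2)\<^sup>2 + (x' $ 3)\<^sup>2) = 1" using norm_vec3[of x'] x'1 by simp
  then have e: "rot_x t x' = vector [0, 0, 1]" using t x'1 by (simp add: rot_x_def)
  have "zonal_real l x y = zonal_real l (rot_x t x') (rot_x t y')"
    by (simp add: zonal_real_rot_x n) (simp add: x'_def y'_def zonal_real_rot_z)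
  also have "\<dots> = poly (legendre_poly l) 1 * poly (legendre_poly l) (rot_x t y' $ 3)"
    unfolding e by (simp add: zonal_real_def plain_harm_def complex_eq_iff zero_complex.ctr[symmetric] power_0_left)
  also have "rot_x t y' $ 3 = rot_x t x' \<bullet> rot_x t y'"
    unfolding e inner_vec_def sum_3 by simp
  also have "\<dots> = x \<bullet> y" by (simp add: inner_rot_x) (simp add: x'_def y'_def inner_rot_z)
  finally show ?thesis .
qed

section \<open>Rotation invariance of the surface measure\<close>

lemma space_sphere_measure [simp]: "space sphere_measure = UNIV"
  unfolding sphere_measure_def space_scale_measure space_distr by (rule space_borel)

lemma sets_sphere_measure [simp, measurable_cong]: "sets sphere_measure = sets borel"
  unfolding sphere_measure_def sets_scale_measure sets_distr by (rule refl)

lemma borel_measurable_normalize: "(\<lambda>x :: real^3. x /\<^sub>R norm x) \<in> borel_measurable borel"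
  by (intro borel_measurable_scaleR borel_measurable_inverse borel_measurable_norm measurable_ident_sets refl)

text \<open>Reduces finiteness, positivity and invariance of the surface measure to Lebesgue measure
  of open cones.\<close>

lemma emeasure_sphere_measure:
  assumes A: "A \<in> sets borel"
  shows "emeasure sphere_measure A = 3 * emeasure lborel {x \<in> ball 0 1 - {0}. x /\<^sub>R norm x \<in> A}"
proof -
  let ?R = "restrict_space lborel (ball 0 1 - {0 :: real^3})"
  have m: "(\<lambda>x. x /\<^sub>R norm x) \<in> measurable ?R borel"
    by (rule measurable_restrict_space1) (simp only: measurable_lborel2 borel_measurable_normalize)
  have "{x \<in> ball 0 1 - {0}. x /\<^sub>R norm x \<in> A} = (\<lambda>x. x /\<^sub>R norm x) -` A \<inter> space ?R"
    unfolding space_restrict_space by (rule set_eqI) (simp add: conj_ac)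
  moreover have "emeasure (distr ?R borel (\<lambda>x. x /\<^sub>R norm x)) A = emeasure lborel ((\<lambda>x. x /\<^sub>R norm x) -` A \<inter> space ?R)"
    unfolding emeasure_distr[OF m A]
  proof (rule emeasure_restrict_space)
    show "(ball 0 1 - {0 :: real^3}) \<inter> space lborel \<in> sets lborel"
      by (intro sets.Int sets.Diff) simp_all
    show "(\<lambda>x. x /\<^sub>R norm x) -` A \<inter> space ?R \<subseteq> ball 0 1 - {0}"
      unfolding space_restrict_space by (rule subset_trans[OF Int_lower2 Int_lower1])
  qed
  ultimately show ?thesis unfolding sphere_measure_def emeasure_scale_measure by (simp only:)
qed

lemma finite_measure_sphere_measure: "finite_measure sphere_measure"
proof
  have "emeasure lborel {x \<in> ball 0 1 - {0 :: real^3}. x /\<^sub>R norm x \<in> UNIV} \<le> emeasure lborel (ball 0 1 :: (real^3) set)"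
    by (intro emeasure_mono) auto
  also have "\<dots> < \<infinity>" by (rule emeasure_lborel_ball_finite)
  finally show "emeasure sphere_measure (space sphere_measure) \<noteq> \<infinity>"
    by (simp add: emeasure_sphere_measure ennreal_mult_eq_top_iff)
qed

text \<open>Radial projection yields unit vectors only, so the cone over the complement of the
  sphere is empty.\<close>

lemma AE_sphere_measure_norm: "AE x in sphere_measure. norm x = 1"
proof (rule AE_I)
  show "emeasure sphere_measure {x. norm x \<noteq> 1} = 0"
  proof -
    have "norm (x /\<^sub>R norm x) = 1" if "x \<noteq> 0" for x :: "real^3"
      using that by simp
    then have "{x \<in> ball 0 1 - {0}. x /\<^sub>R norm x \<in> {x :: real^3. norm x \<noteq> 1}} = {}"
      by blast
    moreover have "{x :: real^3. norm x \<noteq> 1} \<in> sets borel" by measurable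
    ultimately show ?thesis by (simp only: emeasure_sphere_measure emeasure_empty mult_zero_right)
  qed
qed auto

lemma emeasure_sphere_measure_pos: "emeasure sphere_measure UNIV > 0"
proof -
  have "emeasure lborel (ball 0 1 - {0 :: real^3}) = emeasure lborel (ball 0 1 :: (real^3) set)"
    by (subst emeasure_Diff) auto
  also have "\<dots> > 0"
    using content_ball_pos[of 1 "0 :: real^3"] emeasure_lborel_ball_finite[of "0 :: real^3" 1]
    by (simp add: measure_def enn2real_positive_iff)
  finally show ?thesis
    by (simp add: emeasure_sphere_measure set_diff_eq ennreal_zero_less_mult_iff)
qed

text \<open>Orthogonal maps preserve norms, hence commute with radial projection and with forming
  cones, and they preserve Lebesgue measure.\<close>

lemma distr_sphere_measure_orthogonal:
  fixes \<rho> :: "real^3^3"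
  assumes "orthogonal_matrix \<rho>"
  shows "distr sphere_measure borel ((*v) \<rho>) = sphere_measure"
proof (rule measure_eqI)
  have o: "orthogonal_transformation ((*v) \<rho>)"
    using assms by (simp add: orthogonal_transformation_matrix)
  have n [simp]: "norm (\<rho> *v x) = norm x" for x
    using o by (simp add: orthogonal_transformation)
  have m [measurable]: "(*v) \<rho> \<in> borel_measurable borel"
    by (intro borel_measurable_continuous_onI matrix_vector_mult_linear_continuous_on)
  fix A assume "A \<in> sets (distr sphere_measure borel ((*v) \<rho>))"
  then have A [measurable]: "A \<in> sets borel" by simp
  define C where "C B = {x \<in> ball 0 1 - {0 :: real^3}. x /\<^sub>R norm x \<in> B}" for B
  have C [measurable]: "C B \<in> sets borel" if [measurable]: "B \<in> sets borel" for B
  proof -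
    have "C B = {x \<in> space borel. x \<in> ball 0 1 - {0} \<and> x /\<^sub>R norm x \<in> B}" by (auto simp: C_def)
    also have "\<dots> \<in> sets borel"
    proof (rule sets.sets_Collect_conj)
      show "{x \<in> space borel. x \<in> ball 0 1 - {0 :: real^3}} \<in> sets borel" by (simp add: sets.Diff)
      show "{x \<in> space borel. x /\<^sub>R norm x \<in> B} \<in> sets borel"
        using measurable_sets[OF borel_measurable_normalize that] by (simp add: vimage_def)
    qed
    finally show ?thesis .
  qed
  \<comment> \<open>Invariance is invoked for \<open>measure lebesgue\<close> on sets of finite
    measure; boundedness provides the finiteness and allows the return to
    \<open>emeasure\<close>.\<close>
  have lm: "C B \<in> lmeasurable" if "B \<in> sets borel" for B
  proof (rule bounded_set_imp_lmeasurable)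
    show "bounded (C B)" by (rule bounded_subset[OF bounded_ball[of 0 1]]) (unfold C_def, blast)
    show "C B \<in> sets lebesgue" using C[OF that] by simp
  qed
  have B: "(*v) \<rho> -` A \<in> sets borel"
    using measurable_sets[OF m A] by simp
  have C_rot: "\<rho> *v y \<in> C A \<longleftrightarrow> y \<in> C ((*v) \<rho> -` A)" for y
  proof -
    have "\<rho> *v y = 0 \<longleftrightarrow> y = 0" by (metis n norm_eq_zero)
    moreover have "\<rho> *v (y /\<^sub>R norm y) = (\<rho> *v y) /\<^sub>R norm (\<rho> *v y)"
      by (simp only: matrix_vector_mult_scaleR n)
    ultimately show ?thesis unfolding C_def by (simp only: mem_Collect_eq Diff_iff mem_ball_0 n singleton_iff vimage_eq)
  qed
  then have "C ((*v) \<rho> -` A) = (*v) \<rho> -` C A"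
    by (intro set_eqI) (simp only: vimage_eq C_rot)
  then have "C A = (*v) \<rho> ` C ((*v) \<rho> -` A)"
    using surj_image_vimage_eq[OF orthogonal_transformation_surj[OF o], of "C A"] by (simp only:)
  then have "measure lebesgue (C A) = measure lebesgue (C ((*v) \<rho> -` A))"
    using measure_orthogonal_image[OF o lm[OF B]] by simp
  then have "emeasure lebesgue (C A) = emeasure lebesgue (C ((*v) \<rho> -` A))"
    using lm[OF A] lm[OF B] by (simp add: emeasure_eq_measure2 fmeasurableD2)
  then have "emeasure lborel (C A) = emeasure lborel (C ((*v) \<rho> -` A))"
    using C[OF A] C[OF B] by simp
  then have "emeasure sphere_measure ((*v) \<rho> -` A) = emeasure sphere_measure A"
    unfolding emeasure_sphere_measure[OF A] emeasure_sphere_measure[OF B] C_def by simp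
  then show "emeasure (distr sphere_measure borel ((*v) \<rho>)) A = emeasure sphere_measure A"
    by (simp add: emeasure_distr)
qed simp

section \<open>Degree components and rotations\<close>

text \<open>A continuous factor may be unbounded on the whole space, but it is bounded on the
  compact sphere, which carries the measure.\<close>

lemma integrable_mult_continuous_sphere:
  fixes f g :: "real^3 \<Rightarrow> 'b::{real_normed_field,banach,second_countable_topology}"
  assumes f: "integrable sphere_measure f" and g: "continuous_on UNIV g"
  shows "integrable sphere_measure (\<lambda>x. f x * g x)"
proof -
  have "bounded (g ` sphere 0 1)"
    by (intro compact_imp_bounded compact_continuous_image continuous_on_subset[OF g]) auto
  then obtain B where "\<forall>y\<in>g ` sphere 0 1. norm y \<le> B"
    unfolding bounded_iff by blast
  then have B: "\<And>x. norm x = 1 \<Longrightarrow> norm (g x) \<le> B" by simp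
  show ?thesis
  proof (rule Bochner_Integration.integrable_bound)
    show "integrable sphere_measure (\<lambda>x. B * norm (f x))" using f by simp
    have "g \<in> borel_measurable sphere_measure"
      using borel_measurable_continuous_onI[OF g] measurable_cong_sets[OF sets_sphere_measure refl] by blast
    then show "(\<lambda>x. f x * g x) \<in> borel_measurable sphere_measure"
      by (rule borel_measurable_times[OF borel_measurable_integrable[OF f]])
    show "AE x in sphere_measure. norm (f x * g x) \<le> norm (B * norm (f x))"
      using AE_sphere_measure_norm
    proof eventually_elim
      case (elim x)
      have "norm (f x * g x) = norm (g x) * norm (f x)" by (simp add: norm_mult mult.commute)
      also have "\<dots> \<le> B * norm (f x)" using B[OF elim] by (intro mult_right_mono) auto
      also have "\<dots> \<le> norm (B * norm (f x))" unfolding real_norm_def by (rule abs_ge_self)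
      finally show ?case .
    qed
  qed
qed

lemma continuous_on_sph_harm: "continuous_on UNIV (sph_harm l m)"
proof -
  have "Complex a b = of_real a + \<i> * of_real b" for a b by (simp add: complex_eq_iff)
  then have "continuous_on UNIV (sph_harm_nonneg l k)" for k
    unfolding sph_harm_nonneg_def by (simp only:) (intro continuous_intros)
  then show ?thesis
    unfolding sph_harm_def by (cases "m \<ge> 0") (auto intro!: continuous_intros)
qed

lemma measurable_matrix_vector_mult: "(*v) (\<rho> :: real^3^3) \<in> borel_measurable borel"
  by (intro borel_measurable_continuous_onI matrix_vector_mult_linear_continuous_on)

lemma
  fixes g :: "real^3 \<Rightarrow> 'b::{banach,second_countable_topology}" and \<rho> :: "real^3^3"
  assumes \<rho>: "orthogonal_matrix \<rho>" and g: "g \<in> borel_measurable borel"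
  shows integral_sphere_measure_orthogonal:
      "(\<integral>x. g (\<rho> *v x) \<partial>sphere_measure) = (\<integral>x. g x \<partial>sphere_measure)"
    and integrable_sphere_measure_orthogonal:
      "integrable sphere_measure (\<lambda>x. g (\<rho> *v x)) \<longleftrightarrow> integrable sphere_measure g"
proof -
  have m: "(*v) \<rho> \<in> measurable sphere_measure borel"
    using measurable_matrix_vector_mult[of \<rho>] measurable_cong_sets[OF sets_sphere_measure refl] by blast
  show "(\<integral>x. g (\<rho> *v x) \<partial>sphere_measure) = (\<integral>x. g x \<partial>sphere_measure)"
    using integral_distr[OF m g] unfolding distr_sphere_measure_orthogonal[OF \<rho>] by (rule sym)
  show "integrable sphere_measure (\<lambda>x. g (\<rho> *v x)) \<longleftrightarrow> integrable sphere_measure g"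
    using integrable_distr_eq[OF m g] unfolding distr_sphere_measure_orthogonal[OF \<rho>] by (rule sym)
qed

lemma orthogonal_matrix_norm_mult [simp]:
  fixes \<rho> :: "real^3^3"
  assumes "orthogonal_matrix \<rho>"
  shows "norm (\<rho> *v x) = norm x"
  using assms orthogonal_transformation_matrix[of "(*v) \<rho>"] by (simp add: orthogonal_transformation)

text \<open>By the addition theorem only the inner product enters. The addition theorem is about
  unit vectors, so the substitutions below use this identity almost everywhere.\<close>

lemma zonal_orthogonal:
  fixes \<rho> :: "real^3^3"
  assumes \<rho>: "orthogonal_matrix \<rho>" and x: "norm x = 1" and y: "norm y = 1"
  shows "zonal l (\<rho> *v x) (\<rho> *v y) = zonal l x y"
proof -
  have "orthogonal_transformation ((*v) \<rho>)" using \<rho> by (simp add: orthogonal_transformation_matrix)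
  then have "(\<rho> *v x) \<bullet> (\<rho> *v y) = x \<bullet> y" by (simp add: orthogonal_transformation_def)
  then show ?thesis
    using x y by (simp add: zonal_eq_zonal_real addition_theorem orthogonal_matrix_norm_mult[OF \<rho>])
qed

text \<open>The degree-\<open>l\<close> component of \<open>f\<close>. Unlike its separate
  coefficients, it is simply carried along by a rotation.\<close>

definition projection :: "nat \<Rightarrow> (real^3 \<Rightarrow> real) \<Rightarrow> real^3 \<Rightarrow> complex" where
  "projection l f x = (\<Sum>m\<in>{-int l..int l}. sh_coeff f l m * sph_harm l m x)"

lemma borel_measurable_zonal: "zonal l x \<in> borel_measurable borel"
  unfolding zonal_def[abs_def]
  by (intro borel_measurable_continuous_onI continuous_intros continuous_on_sph_harm)

lemma borel_measurable_projection: "projection l f \<in> borel_measurable borel"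
  unfolding projection_def[abs_def]
  by (intro borel_measurable_continuous_onI continuous_intros continuous_on_sph_harm)

context
  fixes f :: "real^3 \<Rightarrow> real"
  assumes f: "integrable sphere_measure f"
begin

lemma integrable_mult_sph_harm:
  "integrable sphere_measure (\<lambda>y. of_real (f y) * sph_harm l m y)"
  "integrable sphere_measure (\<lambda>y. of_real (f y) * cnj (sph_harm l m y))"
  by (rule integrable_mult_continuous_sphere; intro integrable_of_real f continuous_intros continuous_on_sph_harm)+

lemma projection_eq_integral: "projection l f x = (\<integral>y. of_real (f y) * zonal l x y \<partial>sphere_measure)"
proof -
  have "projection l f x = (\<Sum>m\<in>{-int l..int l}. \<integral>y. sph_harm l m x * (of_real (f y) * cnj (sph_harm l m y)) \<partial>sphere_measure)"
    unfolding projection_def sh_coeff_def by (intro sum.cong refl) (subst integral_mult_right_zero, simp only: mult.commute)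
  also have "\<dots> = (\<integral>y. (\<Sum>m\<in>{-int l..int l}. sph_harm l m x * (of_real (f y) * cnj (sph_harm l m y))) \<partial>sphere_measure)"
    by (intro Bochner_Integration.integral_sum[symmetric] integrable_mult_right integrable_mult_sph_harm)
  finally show ?thesis
    unfolding zonal_def sum_distrib_left by (simp only: mult.left_commute)
qed

text \<open>Since \<open>f\<close> is real, conjugating a coefficient conjugates only the harmonic;
  the sum of \<open>a * cnj a\<close> then reassembles the component under the integral.\<close>

lemma degree_norm_eq_integral:
  "complex_of_real ((degree_norm f l)\<^sup>2) = (\<integral>x. of_real (f x) * projection l f x \<partial>sphere_measure)"
proof -
  have "cnj (sh_coeff f l m) = (\<integral>x. of_real (f x) * sph_harm l m x \<partial>sphere_measure)" for m
    unfolding sh_coeff_def by (subst Bochner_Integration.integral_cnj[symmetric]) simp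
  then have *: "complex_of_real ((cmod (sh_coeff f l m))\<^sup>2) = (\<integral>x. sh_coeff f l m * (of_real (f x) * sph_harm l m x) \<partial>sphere_measure)" for m
    by (simp only: complex_norm_square integral_mult_right_zero)
  have "complex_of_real ((degree_norm f l)\<^sup>2) = (\<Sum>m\<in>{-int l..int l}. complex_of_real ((cmod (sh_coeff f l m))\<^sup>2))"
    unfolding degree_norm_def by (subst real_sqrt_pow2) (auto intro!: sum_nonneg)
  also have "\<dots> = (\<integral>x. (\<Sum>m\<in>{-int l..int l}. sh_coeff f l m * (of_real (f x) * sph_harm l m x)) \<partial>sphere_measure)"
    unfolding * by (intro Bochner_Integration.integral_sum[symmetric] integrable_mult_right integrable_mult_sph_harm)
  finally show ?thesis
    unfolding projection_def sum_distrib_left by (simp only: mult.left_commute)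
qed

end

context
  fixes f :: "real^3 \<Rightarrow> real" and \<rho> :: "real^3^3"
  assumes f: "integrable sphere_measure f" "f \<in> borel_measurable borel" and \<rho>: "orthogonal_matrix \<rho>"
begin

lemma integrable_rotate: "integrable sphere_measure (\<lambda>y. f (\<rho> *v y))"
  using f integrable_sphere_measure_orthogonal[OF \<rho> f(2)] by simp

text \<open>Rotating both arguments of the kernel and substituting \<open>\<rho> *v y\<close> for
  \<open>y\<close> moves the rotation onto \<open>x\<close>.\<close>

lemma projection_rotate:
  assumes x: "norm x = 1"
  shows "projection l (\<lambda>y. f (\<rho> *v y)) x = projection l f (\<rho> *v x)"
proof -
  define g where "g y = complex_of_real (f y) * zonal l (\<rho> *v x) y" for y
  have g: "g \<in> borel_measurable borel"
    unfolding g_def[abs_def] by (intro borel_measurable_times measurable_compose[OF f(2) borel_measurable_of_real] borel_measurable_zonal)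
  have z: "zonal l u \<in> borel_measurable sphere_measure" for u
    using borel_measurable_zonal measurable_cong_sets[OF sets_sphere_measure refl] by blast
  have gm: "(\<lambda>y. g (\<rho> *v y)) \<in> borel_measurable sphere_measure"
    using measurable_compose[OF measurable_matrix_vector_mult g] measurable_cong_sets[OF sets_sphere_measure refl] by blast
  have fm: "(\<lambda>y. f (\<rho> *v y)) \<in> borel_measurable sphere_measure"
    using measurable_compose[OF measurable_matrix_vector_mult f(2)] measurable_cong_sets[OF sets_sphere_measure refl] by blast
  have "projection l (\<lambda>y. f (\<rho> *v y)) x = (\<integral>y. of_real (f (\<rho> *v y)) * zonal l x y \<partial>sphere_measure)"
    by (rule projection_eq_integral[OF integrable_rotate])
  also have "\<dots> = (\<integral>y. g (\<rho> *v y) \<partial>sphere_measure)"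
  proof (rule Bochner_Integration.integral_cong_AE)
    show "AE y in sphere_measure. of_real (f (\<rho> *v y)) * zonal l x y = g (\<rho> *v y)"
      using AE_sphere_measure_norm
    proof eventually_elim
      case (elim y)
      then show ?case using zonal_orthogonal[OF \<rho> x elim] by (simp only: g_def)
    qed
  qed (intro borel_measurable_times measurable_compose[OF fm borel_measurable_of_real] z gm)+
  also have "\<dots> = (\<integral>y. g y \<partial>sphere_measure)"
    by (rule integral_sphere_measure_orthogonal[OF \<rho> g])
  also have "\<dots> = projection l f (\<rho> *v x)"
    unfolding g_def by (rule projection_eq_integral[OF f(1), symmetric])
  finally show ?thesis .
qed

text \<open>The same substitution in the outer integral, with the component inside already known to
  rotate.\<close>

lemma degree_norm_rotate: "degree_norm (\<lambda>y. f (\<rho> *v y)) l = degree_norm f l"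
proof -
  define g where "g y = complex_of_real (f y) * projection l f y" for y
  have g: "g \<in> borel_measurable borel"
    unfolding g_def[abs_def] by (intro borel_measurable_times measurable_compose[OF f(2) borel_measurable_of_real] borel_measurable_projection)
  have "complex_of_real ((degree_norm (\<lambda>y. f (\<rho> *v y)) l)\<^sup>2) =
      (\<integral>x. of_real (f (\<rho> *v x)) * projection l (\<lambda>y. f (\<rho> *v y)) x \<partial>sphere_measure)"
    by (rule degree_norm_eq_integral[OF integrable_rotate])
  also have "\<dots> = (\<integral>x. g (\<rho> *v x) \<partial>sphere_measure)"
  proof (rule Bochner_Integration.integral_cong_AE)
    show "AE x in sphere_measure. of_real (f (\<rho> *v x)) * projection l (\<lambda>y. f (\<rho> *v y)) x = g (\<rho> *v x)"
      using AE_sphere_measure_norm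
    proof eventually_elim
      case (elim x)
      then show ?case using projection_rotate[OF elim] by (simp only: g_def)
    qed
    have P: "projection l (\<lambda>y. f (\<rho> *v y)) \<in> borel_measurable sphere_measure"
      unfolding measurable_cong_sets[OF sets_sphere_measure refl] by (rule borel_measurable_projection)
    show "(\<lambda>x. of_real (f (\<rho> *v x)) * projection l (\<lambda>y. f (\<rho> *v y)) x) \<in> borel_measurable sphere_measure"
      by (intro borel_measurable_times P borel_measurable_integrable integrable_of_real integrable_rotate)
    show "(\<lambda>x. g (\<rho> *v x)) \<in> borel_measurable sphere_measure"
      using measurable_compose[OF measurable_matrix_vector_mult g] measurable_cong_sets[OF sets_sphere_measure refl] by blast
  qed
  also have "\<dots> = (\<integral>x. g x \<partial>sphere_measure)"
    by (rule integral_sphere_measure_orthogonal[OF \<rho> g])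
  also have "\<dots> = complex_of_real ((degree_norm f l)\<^sup>2)"
    unfolding g_def by (rule degree_norm_eq_integral[OF f(1), symmetric])
  finally have "(degree_norm (\<lambda>y. f (\<rho> *v y)) l)\<^sup>2 = (degree_norm f l)\<^sup>2"
    by (simp only: of_real_eq_iff)
  moreover have "degree_norm h l \<ge> 0" for h
    unfolding degree_norm_def by (intro real_sqrt_ge_zero sum_nonneg zero_le_power2)
  ultimately show ?thesis by (metis power2_eq_imp_eq)
qed

end

text \<open>The threshold and the factor do not involve \<open>m\<close>, so they come out of the
  inner sum.\<close>

lemma reg_sum_eq_projection:
  "(\<Sum>m\<in>{-int l..int l}. reg_coeff lam beta f l m * sph_harm l m x) =
     (if degree_norm f l > lam * beta l then of_real (1 - lam * beta l / degree_norm f l) * projection l f x else 0)"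
  by (simp add: reg_coeff_def projection_def sum_distrib_left mult.assoc)

lemma regularized_field_rotate:
  assumes "integrable sphere_measure (T \<omega>)" "T \<omega> \<in> borel_measurable borel" "orthogonal_matrix \<rho>" "norm x = 1"
  shows "regularized_field lam beta T \<omega> (\<rho> *v x) = regularized_field lam beta (\<lambda>\<omega> y. T \<omega> (\<rho> *v y)) \<omega> x"
  unfolding regularized_field_def reg_sum_eq_projection degree_norm_rotate[OF assms(1-3)] projection_rotate[OF assms] ..

section \<open>The law of the regularized field\<close>

text \<open>Isolates the dependence on the coefficients, so that the law of the regularized field
  becomes an image of their joint law.\<close>

definition reg_series :: "real \<Rightarrow> (nat \<Rightarrow> real) \<Rightarrow> (nat \<Rightarrow> int \<Rightarrow> complex) \<Rightarrow> real^3 \<Rightarrow> real" where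
  "reg_series lam beta a x = Re (\<Sum>l. \<Sum>m\<in>{-int l..int l}.
     (if sqrt (\<Sum>m\<in>{-int l..int l}. (cmod (a l m))\<^sup>2) > lam * beta l
      then complex_of_real (1 - lam * beta l / sqrt (\<Sum>m\<in>{-int l..int l}. (cmod (a l m))\<^sup>2)) * a l m
      else 0) * sph_harm l m x)"

lemma regularized_field_eq_reg_series:
  "regularized_field lam beta T \<omega> x = reg_series lam beta (sh_coeff (T \<omega>)) x"
  unfolding regularized_field_def reg_series_def reg_coeff_def degree_norm_def ..

text \<open>Where the series diverges, \<open>suminf\<close> has a fixed junk value, so no convergence is needed.\<close>

lemma borel_measurable_reg_series:
  assumes [measurable]: "\<And>l m. (\<lambda>\<omega>. a \<omega> l m) \<in> borel_measurable N"
  shows "(\<lambda>\<omega>. reg_series lam beta (a \<omega>) x) \<in> borel_measurable N"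
  unfolding reg_series_def by measurable

text \<open>The Boolean selects real or imaginary part.\<close>

definition sph_harm_part :: "nat \<times> int \<times> bool \<Rightarrow> real^3 \<Rightarrow> real" where
  "sph_harm_part = (\<lambda>(l, m, b) y. if b then Re (cnj (sph_harm l m y)) else Im (cnj (sph_harm l m y)))"

text \<open>Decodes a real family over a countable index, the shape in which laws of integrals are
  compared, into complex coefficients.\<close>

definition coeff_of_parts :: "(nat \<times> int \<times> bool \<Rightarrow> real) \<Rightarrow> nat \<Rightarrow> int \<Rightarrow> complex" where
  "coeff_of_parts c l m = of_real (c (l, m, True)) + \<i> * of_real (c (l, m, False))"

lemma continuous_on_sph_harm_part: "continuous_on UNIV (sph_harm_part j)"
  unfolding sph_harm_part_def case_prod_beta
  by (cases "snd (snd j)") (auto intro!: continuous_intros continuous_on_sph_harm)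

lemma sh_coeff_eq_parts:
  assumes f: "integrable sphere_measure f"
  shows "sh_coeff f l m = coeff_of_parts (\<lambda>j. \<integral>y. f y * sph_harm_part j y \<partial>sphere_measure) l m"
proof -
  note i = integrable_mult_sph_harm(2)[OF f, of l m]
  have "(\<integral>y. f y * sph_harm_part (l, m, True) y \<partial>sphere_measure) = Re (sh_coeff f l m)"
    unfolding sh_coeff_def integral_Re[OF i, symmetric] by (simp add: sph_harm_part_def)
  moreover have "(\<integral>y. f y * sph_harm_part (l, m, False) y \<partial>sphere_measure) = Im (sh_coeff f l m)"
    unfolding sh_coeff_def integral_Im[OF i, symmetric] by (simp add: sph_harm_part_def)
  ultimately show ?thesis by (simp add: coeff_of_parts_def complex_eq_iff)
qed

text \<open>Sampling requires a probability measure. The total mass is kept symbolic: that it is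
  positive and finite suffices for the normalisation.\<close>

definition uniform_sphere :: "(real^3) measure" where
  "uniform_sphere = density sphere_measure (\<lambda>_. ennreal (1 / measure sphere_measure UNIV))"

lemma sets_uniform_sphere: "sets uniform_sphere = sets borel"
  unfolding uniform_sphere_def sets_density by (rule sets_sphere_measure)

lemma measure_sphere_measure_pos: "measure sphere_measure UNIV > 0"
  using emeasure_sphere_measure_pos finite_measure.emeasure_eq_measure[OF finite_measure_sphere_measure, of UNIV]
  by simp

lemma prob_space_uniform_sphere: "prob_space uniform_sphere"
proof
  have "emeasure uniform_sphere UNIV = ennreal (1 / measure sphere_measure UNIV) * emeasure sphere_measure UNIV"
    unfolding uniform_sphere_def by (subst emeasure_density_const) auto
  also have "\<dots> = 1"
    unfolding finite_measure.emeasure_eq_measure[OF finite_measure_sphere_measure]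
    using measure_sphere_measure_pos by (simp flip: ennreal_mult)
  finally show "emeasure uniform_sphere (space uniform_sphere) = 1"
    by (simp add: uniform_sphere_def)
qed

lemma
  fixes f :: "real^3 \<Rightarrow> real"
  assumes f: "f \<in> borel_measurable borel"
  shows integral_uniform_sphere:
      "(\<integral>y. measure sphere_measure UNIV * f y \<partial>uniform_sphere) = (\<integral>y. f y \<partial>sphere_measure)"
    and integrable_uniform_sphere:
      "integrable uniform_sphere f \<longleftrightarrow> integrable sphere_measure f"
proof -
  let ?c = "measure sphere_measure UNIV"
  have m: "f \<in> borel_measurable sphere_measure" "(\<lambda>y. ?c * f y) \<in> borel_measurable sphere_measure"
    using f by (simp_all add: measurable_cong_sets[OF sets_sphere_measure refl])
  show "(\<integral>y. ?c * f y \<partial>uniform_sphere) = (\<integral>y. f y \<partial>sphere_measure)"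
    unfolding uniform_sphere_def
    by (subst integral_density) (use m measure_sphere_measure_pos in auto)
  show "integrable uniform_sphere f \<longleftrightarrow> integrable sphere_measure f"
    unfolding uniform_sphere_def
    by (subst integrable_density) (use m measure_sphere_measure_pos in \<open>auto simp: divide_inverse\<close>)
qed

lemma AE_uniform_sphere_norm: "AE y in uniform_sphere. norm y = 1"
  unfolding uniform_sphere_def by (subst AE_density) (use AE_sphere_measure_norm in auto)

text \<open>Fubini gives square integrability of almost every realization, and finiteness of the
  surface measure then gives integrability.\<close>

lemma AE_L2_field:
  assumes "prob_space M" "L2_field M Z"
  shows "AE \<omega> in M. Z \<omega> \<in> borel_measurable borel \<and> integrable sphere_measure (Z \<omega>) \<and>
    integrable sphere_measure (\<lambda>y. (Z \<omega> y)\<^sup>2)"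
proof -
  interpret M: prob_space M by fact
  interpret S: finite_measure sphere_measure by (rule finite_measure_sphere_measure)
  interpret MS: pair_sigma_finite M sphere_measure ..
  have Zm: "case_prod Z \<in> borel_measurable (M \<Otimes>\<^sub>M sphere_measure)"
    and Zi: "integrable (M \<Otimes>\<^sub>M sphere_measure) (\<lambda>(\<omega>, x). (Z \<omega> x)\<^sup>2)"
    using assms unfolding L2_field_def random_field_def by simp_all
  have "AE \<omega> in M. integrable sphere_measure (\<lambda>y. (Z \<omega> y)\<^sup>2)"
    using MS.AE_integrable_fst'[OF Zi] by simp
  then show ?thesis
    using AE_space
  proof eventually_elim
    case (elim \<omega>)
    have Z: "Z \<omega> \<in> borel_measurable sphere_measure"
      using measurable_Pair2[OF Zm elim(2)] by simp
    have "Z \<omega> \<in> borel_measurable borel"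
      using Z unfolding measurable_cong_sets[OF sets_sphere_measure refl] .
    with elim(1) S.square_integrable_imp_integrable[OF Z elim(1)] show ?case by blast
  qed
qed

text \<open>Replacing variables almost surely under \<open>distr\<close> requires both to be
  measurable. Exceptional realizations cause no trouble: the Bochner integral is 0 where undefined
  and stays measurable in the parameter.\<close>

lemma borel_measurable_regularized_field:
  assumes "L2_field M Z"
  shows "(\<lambda>\<omega>. regularized_field lam beta Z \<omega> x) \<in> borel_measurable M"
  unfolding regularized_field_eq_reg_series
proof (rule borel_measurable_reg_series)
  fix l m
  interpret S: finite_measure sphere_measure by (rule finite_measure_sphere_measure)
  have Zm: "case_prod Z \<in> borel_measurable (M \<Otimes>\<^sub>M sphere_measure)"
    using assms unfolding L2_field_def random_field_def by simp
  have Y: "(\<lambda>y. cnj (sph_harm l m y)) \<in> borel_measurable sphere_measure"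
    unfolding measurable_cong_sets[OF sets_sphere_measure refl]
    by (intro borel_measurable_continuous_onI continuous_intros continuous_on_sph_harm)
  have "(\<lambda>(\<omega>, y). of_real (Z \<omega> y) * cnj (sph_harm l m y)) \<in> borel_measurable (M \<Otimes>\<^sub>M sphere_measure)"
    using borel_measurable_times[OF measurable_compose[OF Zm borel_measurable_of_real]
        measurable_compose[OF measurable_snd Y]]
    by (simp only: case_prod_beta')
  then show "(\<lambda>\<omega>. sh_coeff (Z \<omega>) l m) \<in> borel_measurable M"
    unfolding sh_coeff_def by (rule S.borel_measurable_lebesgue_integral)
qed

lemma distr_regularized_field_eq:
  fixes T T' :: "'a \<Rightarrow> real^3 \<Rightarrow> real"
  assumes "prob_space M" and L2: "L2_field M T" "L2_field M T'"
    and fdd: "\<And>n ys. (\<And>i. i < n \<Longrightarrow> norm (ys i) = 1) \<Longrightarrow>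
        distr M (PiM {..<n} (\<lambda>_. borel)) (\<lambda>\<omega>. \<lambda>i\<in>{..<n}. T \<omega> (ys i)) =
        distr M (PiM {..<n} (\<lambda>_. borel)) (\<lambda>\<omega>. \<lambda>i\<in>{..<n::nat}. T' \<omega> (ys i))"
  shows "distr M (PiM {..<k} (\<lambda>_. borel)) (\<lambda>\<omega>. \<lambda>i\<in>{..<k}. regularized_field lam beta T \<omega> (xs i)) =
      distr M (PiM {..<k} (\<lambda>_. borel)) (\<lambda>\<omega>. \<lambda>i\<in>{..<k::nat}. regularized_field lam beta T' \<omega> (xs i))"
proof -
  interpret M: prob_space M by fact
  interpret S: finite_measure sphere_measure by (rule finite_measure_sphere_measure)
  define c where "c = measure sphere_measure UNIV"
  \<comment> \<open>The factor \<open>c\<close> undoes the density \<open>1 / c\<close> of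
    \<open>uniform_sphere\<close>, so \<open>I Z\<close> consists of the true coefficient
    parts.\<close>
  define h where "h j y = c * sph_harm_part j y" for j y
  define I where "I Z \<omega> = (\<lambda>j. \<integral>y. Z \<omega> y * h j y \<partial>uniform_sphere)" for Z :: "'a \<Rightarrow> real^3 \<Rightarrow> real" and \<omega>
  have hm: "sph_harm_part j \<in> borel_measurable borel" "h j \<in> borel_measurable borel" for j
    unfolding h_def[abs_def]
    by (intro borel_measurable_continuous_onI continuous_intros continuous_on_sph_harm_part)+
  have sets_eq: "sets (M \<Otimes>\<^sub>M uniform_sphere) = sets (M \<Otimes>\<^sub>M sphere_measure)"
    by (intro sets_pair_measure_cong refl) (simp only: sets_uniform_sphere sets_sphere_measure)
  \<comment> \<open>The outer map on the right does not depend on \<open>Z\<close>, so equal laws of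
    \<open>I T\<close> and \<open>I T'\<close> are enough.\<close>
  have law: "distr M (PiM {..<k} (\<lambda>_. borel)) (\<lambda>\<omega>. \<lambda>i\<in>{..<k}. regularized_field lam beta Z \<omega> (xs i)) =
      distr (distr M borel (I Z)) (PiM {..<k} (\<lambda>_. borel)) (\<lambda>b. \<lambda>i\<in>{..<k}. reg_series lam beta (coeff_of_parts b) (xs i))"
    and sq: "AE \<omega> in M. \<forall>j. integrable uniform_sphere (\<lambda>y. (Z \<omega> y * h j y)\<^sup>2)"
    and meas: "case_prod Z \<in> borel_measurable (M \<Otimes>\<^sub>M uniform_sphere)"
    if Z: "L2_field M Z" for Z
  proof -
    have Zm: "case_prod Z \<in> borel_measurable (M \<Otimes>\<^sub>M sphere_measure)"
      using Z unfolding L2_field_def random_field_def by simp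
    show meas: "case_prod Z \<in> borel_measurable (M \<Otimes>\<^sub>M uniform_sphere)"
      using Zm unfolding measurable_cong_sets[OF sets_eq refl] .
    note AE = AE_L2_field[OF assms(1) Z]
    show "AE \<omega> in M. \<forall>j. integrable uniform_sphere (\<lambda>y. (Z \<omega> y * h j y)\<^sup>2)"
      using AE
    proof eventually_elim
      case (elim \<omega>)
      then have [measurable]: "Z \<omega> \<in> borel_measurable borel" by simp
      show ?case
      proof
        fix j
        have "integrable sphere_measure (\<lambda>y. (Z \<omega> y)\<^sup>2 * (h j y)\<^sup>2)"
          unfolding h_def using elim
          by (intro integrable_mult_continuous_sphere continuous_intros continuous_on_sph_harm_part) simp
        then have "integrable sphere_measure (\<lambda>y. (Z \<omega> y * h j y)\<^sup>2)"
          by (simp only: power_mult_distrib)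
        moreover have "(\<lambda>y. (Z \<omega> y * h j y)\<^sup>2) \<in> borel_measurable borel"
          using elim by (intro borel_measurable_power borel_measurable_times hm) simp_all
        ultimately show "integrable uniform_sphere (\<lambda>y. (Z \<omega> y * h j y)\<^sup>2)"
          by (simp only: integrable_uniform_sphere)
      qed
    qed
    interpret U: prob_space uniform_sphere by (rule prob_space_uniform_sphere)
    have hU: "h j \<in> borel_measurable uniform_sphere" for j
      using hm unfolding measurable_cong_sets[OF sets_uniform_sphere refl] by simp
    have I: "I Z \<in> borel_measurable M"
      unfolding I_def
    proof (rule measurable_coordinatewise_then_product)
      fix j
      have "(\<lambda>(\<omega>, y). Z \<omega> y * h j y) \<in> borel_measurable (M \<Otimes>\<^sub>M uniform_sphere)"
        using borel_measurable_times[OF meas measurable_compose[OF measurable_snd hU[of j]]]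
        by (simp only: case_prod_beta')
      then show "(\<lambda>\<omega>. \<integral>y. Z \<omega> y * h j y \<partial>uniform_sphere) \<in> borel_measurable M"
        by (rule U.borel_measurable_lebesgue_integral)
    qed
    have R: "(\<lambda>b. \<lambda>i\<in>{..<k}. reg_series lam beta (coeff_of_parts b) (xs i)) \<in> measurable borel (PiM {..<k} (\<lambda>_. borel))"
    proof (intro measurable_restrict borel_measurable_reg_series)
      fix l m
      have "(\<lambda>b :: nat \<times> int \<times> bool \<Rightarrow> real. b j) \<in> borel_measurable borel" for j
        by (rule measurable_product_then_coordinatewise[OF measurable_ident_sets[OF refl]])
      then show "(\<lambda>b. coeff_of_parts b l m) \<in> borel_measurable borel"
        unfolding coeff_of_parts_def
        by (intro borel_measurable_add borel_measurable_times borel_measurable_const measurable_compose[OF _ borel_measurable_of_real])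
    qed
    have "distr M (PiM {..<k} (\<lambda>_. borel)) (\<lambda>\<omega>. \<lambda>i\<in>{..<k}. regularized_field lam beta Z \<omega> (xs i)) =
      distr M (PiM {..<k} (\<lambda>_. borel)) (\<lambda>\<omega>. \<lambda>i\<in>{..<k}. reg_series lam beta (coeff_of_parts (I Z \<omega>)) (xs i))"
    proof (rule distr_cong_AE)
      show "AE \<omega> in M. (\<lambda>i\<in>{..<k}. regularized_field lam beta Z \<omega> (xs i)) =
          (\<lambda>i\<in>{..<k}. reg_series lam beta (coeff_of_parts (I Z \<omega>)) (xs i))"
        using AE
      proof eventually_elim
        case (elim \<omega>)
        then have int: "integrable sphere_measure (Z \<omega>)" by simp
        have "I Z \<omega> j = (\<integral>y. Z \<omega> y * sph_harm_part j y \<partial>sphere_measure)" for j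
        proof -
          have "(\<lambda>y. Z \<omega> y * sph_harm_part j y) \<in> borel_measurable borel"
            using elim by (intro borel_measurable_times hm) simp_all
          from integral_uniform_sphere[OF this] show ?thesis
            by (simp only: I_def h_def c_def mult.left_commute)
        qed
        then have "sh_coeff (Z \<omega>) = coeff_of_parts (I Z \<omega>)"
          unfolding fun_eq_iff sh_coeff_eq_parts[OF int] by (simp only: coeff_of_parts_def) simp
        then show ?case unfolding regularized_field_eq_reg_series by simp
      qed
      show "(\<lambda>\<omega>. \<lambda>i\<in>{..<k}. regularized_field lam beta Z \<omega> (xs i)) \<in> measurable M (PiM {..<k} (\<lambda>_. borel))"
        by (intro measurable_restrict borel_measurable_regularized_field assms Z)
      show "(\<lambda>\<omega>. \<lambda>i\<in>{..<k}. reg_series lam beta (coeff_of_parts (I Z \<omega>)) (xs i)) \<in> measurable M (PiM {..<k} (\<lambda>_. borel))"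
        by (rule measurable_compose[OF I R])
    qed simp_all
    also have "\<dots> = distr (distr M borel (I Z)) (PiM {..<k} (\<lambda>_. borel)) (\<lambda>b. \<lambda>i\<in>{..<k}. reg_series lam beta (coeff_of_parts b) (xs i))"
      unfolding distr_distr[OF R I] by (simp only: comp_def)
    finally show "distr M (PiM {..<k} (\<lambda>_. borel)) (\<lambda>\<omega>. \<lambda>i\<in>{..<k}. regularized_field lam beta Z \<omega> (xs i)) =
      distr (distr M borel (I Z)) (PiM {..<k} (\<lambda>_. borel)) (\<lambda>b. \<lambda>i\<in>{..<k}. reg_series lam beta (coeff_of_parts b) (xs i))" .
  qed
  have "distr M borel (I T) = distr M borel (I T')"
    unfolding I_def[abs_def]
  proof (rule distr_integrals_eq[where X = "{y. norm y = 1}"])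
    show "AE y in uniform_sphere. y \<in> {y. norm y = 1}" using AE_uniform_sphere_norm by simp
    show "h j \<in> borel_measurable uniform_sphere" for j
      using hm unfolding measurable_cong_sets[OF sets_uniform_sphere refl] by simp
    show "prob_space M" by fact
    show "prob_space uniform_sphere" by (rule prob_space_uniform_sphere)
  qed (use meas sq L2 in \<open>simp_all add: fdd\<close>)
  then show ?thesis unfolding law[OF L2(1)] law[OF L2(2)] by simp
qed

theorem theorem4p2:
  fixes M :: "'a measure" and T :: "'a \<Rightarrow> real^3 \<Rightarrow> real"
    and beta :: "nat \<Rightarrow> real" and lam :: real
  assumes "prob_space M"
    and "L2_field M T"
    and "\<And>l. beta l > 0"
    and "lam > 0"
    and "strongly_isotropic M T"
  shows "strongly_isotropic M (regularized_field lam beta T)"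
  unfolding strongly_isotropic_def
proof (intro allI impI)
  fix k and xs :: "nat \<Rightarrow> real^3" and \<rho> :: "real^3^3"
  assume xs: "\<forall>i<k. xs i \<in> sphere 0 1" and rot: "rotation_matrix \<rho>"
  interpret M: prob_space M by fact
  interpret S: finite_measure sphere_measure by (rule finite_measure_sphere_measure)
  have \<rho>: "orthogonal_matrix \<rho>" using rot by (simp add: rotation_matrix_def)
  \<comment> \<open>Rotating the input makes isotropy a statement about two fields evaluated at the
    same points.\<close>
  define T' where "T' \<omega> y = T \<omega> (\<rho> *v y)" for \<omega> y
  have Tm: "case_prod T \<in> borel_measurable (M \<Otimes>\<^sub>M sphere_measure)"
    and Ti: "integrable (M \<Otimes>\<^sub>M sphere_measure) (\<lambda>(\<omega>, x). (T \<omega> x)\<^sup>2)"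
    using assms(2) unfolding L2_field_def random_field_def by simp_all
  have rm: "(*v) \<rho> \<in> measurable sphere_measure sphere_measure"
    using measurable_matrix_vector_mult[of \<rho>]
    unfolding measurable_cong_sets[OF sets_sphere_measure sets_sphere_measure] .
  have r: "(\<lambda>(\<omega>, y). (\<omega>, \<rho> *v y)) \<in> measurable (M \<Otimes>\<^sub>M sphere_measure) (M \<Otimes>\<^sub>M sphere_measure)"
    unfolding case_prod_beta by (intro measurable_Pair measurable_fst measurable_compose[OF measurable_snd rm])
  \<comment> \<open>Rotating only the spatial variable preserves the product measure; this transfers
    square integrability from \<open>T\<close> to \<open>T'\<close>.\<close>
  have inv: "distr (M \<Otimes>\<^sub>M sphere_measure) (M \<Otimes>\<^sub>M sphere_measure) (\<lambda>(\<omega>, y). (\<omega>, \<rho> *v y)) = M \<Otimes>\<^sub>M sphere_measure"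
  proof -
    have d: "distr sphere_measure sphere_measure ((*v) \<rho>) = sphere_measure"
      using distr_sphere_measure_orthogonal[OF \<rho>] distr_cong[OF refl sets_sphere_measure refl, of sphere_measure "(*v) \<rho>"]
      by simp
    have "distr M M (\<lambda>x. x) \<Otimes>\<^sub>M distr sphere_measure sphere_measure ((*v) \<rho>) =
      distr (M \<Otimes>\<^sub>M sphere_measure) (M \<Otimes>\<^sub>M sphere_measure) (\<lambda>(\<omega>, y). (\<omega>, \<rho> *v y))"
      by (rule pair_measure_distr[OF measurable_ident_sets[OF refl] rm]) (simp only: d, rule S.sigma_finite_measure_axioms)
    then show ?thesis unfolding d by (simp add: distr_id2)
  qed
  have L2': "L2_field M T'"
    unfolding L2_field_def random_field_def
  proof
    show "(\<lambda>(\<omega>, x). T' \<omega> x) \<in> borel_measurable (M \<Otimes>\<^sub>M sphere_measure)"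
      using measurable_compose[OF r Tm] by (simp add: T'_def case_prod_beta')
    have "integrable (distr (M \<Otimes>\<^sub>M sphere_measure) (M \<Otimes>\<^sub>M sphere_measure) (\<lambda>(\<omega>, y). (\<omega>, \<rho> *v y))) (\<lambda>(\<omega>, x). (T \<omega> x)\<^sup>2)"
      unfolding inv by (rule Ti)
    from integrable_distr[OF r this] show "integrable (M \<Otimes>\<^sub>M sphere_measure) (\<lambda>(\<omega>, x). (T' \<omega> x)\<^sup>2)"
      by (simp add: T'_def case_prod_beta')
  qed
  have "distr M (PiM {..<k} (\<lambda>_. borel)) (\<lambda>\<omega>. \<lambda>i\<in>{..<k}. regularized_field lam beta T \<omega> (xs i)) =
      distr M (PiM {..<k} (\<lambda>_. borel)) (\<lambda>\<omega>. \<lambda>i\<in>{..<k}. regularized_field lam beta T' \<omega> (xs i))"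
    \<comment> \<open>Isotropy of \<open>T\<close> enters here, as equality of the
      finite-dimensional distributions of \<open>T\<close> and \<open>T'\<close>.\<close>
    by (rule distr_regularized_field_eq[OF assms(1,2) L2'])
       (use assms(5) rot in \<open>simp add: T'_def strongly_isotropic_def\<close>)
  also have "\<dots> = distr M (PiM {..<k} (\<lambda>_. borel)) (\<lambda>\<omega>. \<lambda>i\<in>{..<k}. regularized_field lam beta T \<omega> (\<rho> *v xs i))"
  \<comment> \<open>This half is pathwise: for almost every realization, regularization commutes
    with the rotation.\<close>
  proof (rule distr_cong_AE)
    show "AE \<omega> in M. (\<lambda>i\<in>{..<k}. regularized_field lam beta T' \<omega> (xs i)) =
        (\<lambda>i\<in>{..<k}. regularized_field lam beta T \<omega> (\<rho> *v xs i))"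
      using AE_L2_field[OF assms(1,2)]
    proof eventually_elim
      case (elim \<omega>)
      show ?case
        unfolding T'_def using elim xs \<rho>
        by (intro restrict_ext regularized_field_rotate[symmetric]) simp_all
    qed
  qed (intro measurable_restrict borel_measurable_regularized_field assms L2' | simp)+
  finally show "distr M (PiM {..<k} (\<lambda>_. borel)) (\<lambda>\<omega>. \<lambda>i\<in>{..<k}. regularized_field lam beta T \<omega> (xs i)) =
    distr M (PiM {..<k} (\<lambda>_. borel)) (\<lambda>\<omega>. \<lambda>i\<in>{..<k}. regularized_field lam beta T \<omega> (\<rho> *v xs i))" .
qed

end
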